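(* Let $n$ be an integer with $n\in\{8,12,14\}$ or $n\geq 16$. Then $E(P_n^6)>E(C_n)$.
   Context: For a simple graph $G$ on $n$ vertices, let $\lambda_1,\dots,\lambda_n$ be the eigenvalues (with multiplicity) of its adjacency matrix $A(G)$. The energy of $G$ is $E(G)=\sum_{i=1}^n|\lambda_i|$. $C_n$ denotes the cycle on $n$ vertices and $P_m$ the path on $m$ vertices. For $n\geq 7$, $P_n^6$ denotes the unicyclic graph on $n$ vertices obtained from disjoint copies of $C_6$ and $P_{n-6}$ by adding one edge joining a vertex of $C_6$ to a leaf (end vertex) of $P_{n-6}$ (when $n=7$, to the unique vertex of $P_1$). *)

theory Defs
  imports "Jordan_Normal_Form.Spectral_Radius" "Graph_Theory.Pair_Digraph"
begin

text \<open>
  A finite simple graph is a \<^locale>\<open>pair_graph\<close>: finitely many vertices, and an undirected edge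
  between \<open>u\<close> and \<open>v\<close> is the pair of opposite arcs \<open>(u, v)\<close>, \<open>(v, u)\<close>.
\<close>

text \<open>
  Rows and columns follow the increasing enumeration of the vertices. Another enumeration would
  conjugate the matrix by a permutation matrix, which leaves the spectrum unchanged. The entries
  are taken in the complex numbers so that all roots of the characteristic polynomial are present.
\<close>

definition adjacency_matrix :: "'a::linorder pair_pre_digraph \<Rightarrow> complex mat" where
  "adjacency_matrix G =
    (let vs = sorted_list_of_set (pverts G)
     in mat (length vs) (length vs) (\<lambda>(i, j). if (vs ! i, vs ! j) \<in> parcs G then 1 else 0))"

text \<open>
  Each eigenvalue is weighted by its algebraic multiplicity, which equals the geometric one since
  the adjacency matrix of a simple graph is real symmetric.
\<close>

definition graph_energy :: "'a::linorder pair_pre_digraph \<Rightarrow> real" where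
  "graph_energy G =
    (\<Sum>k \<in> spectrum (adjacency_matrix G).
       real (order k (char_poly (adjacency_matrix G))) * cmod k)"

text \<open>This is the cycle \<open>C\<^sub>n\<close> for \<open>n \<ge> 3\<close> only (there is a loop for \<open>n = 1\<close>).\<close>

definition cycle_graph :: "nat \<Rightarrow> nat pair_pre_digraph" where
  "cycle_graph n =
    \<lparr> pverts = {..<n},
      parcs = {(i, j). i < n \<and> j < n \<and> (j = Suc i mod n \<or> i = Suc j mod n)} \<rparr>"

definition path_graph :: "nat \<Rightarrow> nat pair_pre_digraph" where
  "path_graph m =
    \<lparr> pverts = {..<m},
      parcs = {(i, j). i < m \<and> j < m \<and> (j = Suc i \<or> i = Suc j)} \<rparr>"

text \<open>
  \<open>P\<^sub>n\<^sup>6\<close> for \<open>n \<ge> 7\<close>: the path \<open>P\<^bsub>n-6\<^esub>\<close> is made disjoint from \<open>C\<^sub>6\<close> by shifting its vertices by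
  \<open>6\<close>, so that \<open>6\<close> is an end vertex of it, and the joining edge is \<open>{0, 6}\<close>.
\<close>

definition P6_graph :: "nat \<Rightarrow> nat pair_pre_digraph" where
  "P6_graph n =
    \<lparr> pverts = pverts (cycle_graph 6) \<union> (\<lambda>i. i + 6) ` pverts (path_graph (n - 6)),
      parcs = parcs (cycle_graph 6)
        \<union> map_prod (\<lambda>i. i + 6) (\<lambda>i. i + 6) ` parcs (path_graph (n - 6))
        \<union> {(0, 6), (6, 0)} \<rparr>"

lemma adjacency_matrix_carrier:
  "adjacency_matrix G \<in> carrier_mat (card (pverts G)) (card (pverts G))"
  by (simp add: adjacency_matrix_def Let_def)

lemma sum_multiplicities_adjacency_matrix:
  "(\<Sum>k \<in> spectrum (adjacency_matrix G). order k (char_poly (adjacency_matrix G)))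
    = card (pverts G)"
proof -
  let ?p = "char_poly (adjacency_matrix G)"
  have deg: "degree ?p = card (pverts G)" and lc: "coeff ?p (card (pverts G)) = 1"
    using degree_monic_char_poly[OF adjacency_matrix_carrier] by blast+
  have nz: "?p \<noteq> 0" using lc by auto
  have "size (proots ?p) = (\<Sum>k | poly ?p k = 0. order k ?p)"
    using nz by (simp add: size_multiset_overloaded_eq)
  then show ?thesis
    unfolding spectrum_root_char_poly[OF adjacency_matrix_carrier]
    using deg size_proots_complex[of ?p] by simp
qed

lemma pair_graphI:
  assumes "finite (pverts G)"
    and "\<And>u v. (u, v) \<in> parcs G \<Longrightarrow> u \<in> pverts G \<and> u \<noteq> v \<and> (v, u) \<in> parcs G"
  shows "pair_graph G"
proof
  have V: "u \<in> pverts G \<and> v \<in> pverts G" if "(u, v) \<in> parcs G" for u v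
    using assms(2) that by meson
  then have "parcs G \<subseteq> pverts G \<times> pverts G" by auto
  then show "finite (parcs G)" using assms(1) by (meson finite_SigmaI finite_subset)
  show "symmetric (with_proj G)"
    using assms(2) by (auto simp: symmetric_def intro!: symI)
  show "fst e \<in> pverts G" "snd e \<in> pverts G" if "e \<in> parcs G" for e
    using V that by (cases e; simp)+
qed (use assms in \<open>auto simp: with_proj_def\<close>)

lemma pair_graph_cycle_graph: "n \<ge> 3 \<Longrightarrow> pair_graph (cycle_graph n)"
  by (rule pair_graphI) (auto simp: cycle_graph_def mod_Suc split: if_splits)

lemma pair_graph_path_graph: "pair_graph (path_graph m)"
  by (rule pair_graphI) (auto simp: path_graph_def)

lemma pverts_P6_graph: "n \<ge> 7 \<Longrightarrow> pverts (P6_graph n) = {..<n}"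
proof -
  assume n: "n \<ge> 7"
  have "x \<in> (\<lambda>i. i + 6) ` {..<n - 6}" if "x < n" "\<not> x < 6" for x
    using that by (intro image_eqI[of _ _ "x - 6"]) auto
  with n show ?thesis by (auto simp: P6_graph_def cycle_graph_def path_graph_def)
qed

lemma pair_graph_P6_graph:
  assumes "n \<ge> 7" shows "pair_graph (P6_graph n)"
proof (rule pair_graphI)
  show "finite (pverts (P6_graph n))" using assms by (simp add: pverts_P6_graph)
  have C: "u < 6 \<and> u \<noteq> v \<and> (v, u) \<in> parcs (cycle_graph 6)"
    if "(u, v) \<in> parcs (cycle_graph 6)" for u v
    using that by (auto simp: cycle_graph_def mod_Suc split: if_splits)
  fix u v assume uv: "(u, v) \<in> parcs (P6_graph n)"
  then consider "(u, v) \<in> parcs (cycle_graph 6)"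
    | i j where "u = i + 6" "v = j + 6" "(i, j) \<in> parcs (path_graph (n - 6))"
    | "(u, v) \<in> {(0, 6), (6, 0)}"
    by (auto simp: P6_graph_def)
  then show "u \<in> pverts (P6_graph n) \<and> u \<noteq> v \<and> (v, u) \<in> parcs (P6_graph n)"
  proof cases
    case 1
    with C[OF 1] assms show ?thesis by (auto simp: pverts_P6_graph) (simp add: P6_graph_def)
  next
    case 2
    then have "(j, i) \<in> parcs (path_graph (n - 6))" "i < n - 6" "i \<noteq> j"
      by (auto simp: path_graph_def)
    with 2 assms show ?thesis
      by (auto simp: pverts_P6_graph) (force simp: P6_graph_def)
  next
    case 3
    with assms show ?thesis by (auto simp: pverts_P6_graph) (auto simp: P6_graph_def)
  qed
qed

end

theory Submission
  imports Defs "HOL-Real_Asymp.Real_Asymp" "HOL-Analysis.Complex_Transcendental"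
begin

text \<open>
  Coulson's integral formula says that the difference of the energies of two graphs of the same
  order is \<open>1/\<pi>\<close> times the integral of \<open>ln \<bar>\<phi>\<^sub>1(ix)/\<phi>\<^sub>2(ix)\<bar>\<close>. Hence a pointwise comparison of the
  characteristic polynomials on the imaginary axis implies a comparison of energies. With
  \<open>x = Y - 1/Y\<close>, \<open>Y > 1\<close>, one has \<open>\<bar>\<phi>(P\<^sub>n\<^sup>6, ix)\<bar> = A Y\<^sup>n + (-1)\<^sup>n B Y\<^sup>-\<^sup>n\<close>, where \<open>A\<close> and
  \<open>B\<close> do not depend on \<open>n\<close> and \<open>0 \<le> B \<le> A Y\<^sup>1\<^sup>0\<close>, while \<open>\<bar>\<phi>(C\<^sub>n, ix)\<bar>\<close> is
  \<open>Y\<^sup>n + Y\<^sup>-\<^sup>n\<close> plus \<open>-2\<close>, \<open>0\<close> or \<open>2\<close> according to \<open>n mod 4\<close>. It follows that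
  \<open>E(P\<^sub>n\<^sup>6) - E(C\<^sub>n)\<close> increases in \<open>n\<close> along the odd numbers and along the residue class \<open>2\<close>
  modulo \<open>4\<close>, and that its values for \<open>n\<close> divisible by \<open>4\<close> dominate those in that class. This
  leaves \<open>n = 14\<close> and \<open>n = 17\<close>, where sign changes of \<open>\<phi>(P\<^sub>n\<^sup>6)\<close> bound the energy of \<open>P\<^sub>n\<^sup>6\<close> from
  below and \<open>E(C\<^sub>1\<^sub>4) = 4 / sin (\<pi>/14)\<close>, \<open>E(C\<^sub>1\<^sub>7) = 2 / sin (\<pi>/34)\<close>.
\<close>

section \<open>Energy as a sum over the list of roots\<close>

lemma graph_energy_eq_sum_list:
  assumes "char_poly (adjacency_matrix G) = (\<Prod>r\<leftarrow>rs. [:- r, 1:])"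
  shows "graph_energy G = (\<Sum>r\<leftarrow>rs. cmod r)"
proof -
  have ord: "order k (\<Prod>r\<leftarrow>rs. [:- r, 1:]) = count_list rs k" for k :: complex and rs
  proof (induction rs)
    case (Cons r rs)
    have "(\<Prod>r\<leftarrow>rs. [:- r, 1:]) \<noteq> (0 :: complex poly)"
      by (auto simp: prod_list_zero_iff)
    then show ?case
      using Cons by (simp add: order_mult order_linear' del: mult_pCons_left)
  qed simp
  have "spectrum (adjacency_matrix G) = set rs"
    unfolding spectrum_root_char_poly[OF adjacency_matrix_carrier] assms
    by (auto simp: poly_prod_list prod_list_zero_iff)
  moreover have "(\<Sum>k\<in>A. real (count_list rs k) * f k) = (\<Sum>r\<leftarrow>rs. f r)"
    if "finite A" "set rs \<subseteq> A" for rs A and f :: "complex \<Rightarrow> real"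
    using that
  proof (induction rs)
    case (Cons r rs)
    have "(\<Sum>k\<in>A. real (count_list (r # rs) k) * f k)
        = (\<Sum>k\<in>A. real (count_list rs k) * f k + (if k = r then f k else 0))"
      by (intro sum.cong) (auto simp: algebra_simps)
    with Cons show ?case by (simp add: sum.distrib)
  qed simp
  ultimately show ?thesis
    unfolding graph_energy_def assms ord by simp
qed

subsection \<open>Comparing sums of absolute values on the imaginary axis\<close>

lemma sum_list_tendsto:
  fixes f :: "'a \<Rightarrow> 'b \<Rightarrow> real"
  assumes "\<And>a. a \<in> set as \<Longrightarrow> ((\<lambda>x. f a x) \<longlongrightarrow> l a) F"
  shows "((\<lambda>x. \<Sum>a\<leftarrow>as. f a x) \<longlongrightarrow> (\<Sum>a\<leftarrow>as. l a)) F"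
  using assms by (induction as) (auto intro!: tendsto_intros)

lemma sum_list_DERIV:
  fixes f :: "'a \<Rightarrow> real \<Rightarrow> real"
  assumes "\<And>a. a \<in> set as \<Longrightarrow> ((\<lambda>x. f a x) has_real_derivative D a) F"
  shows "((\<lambda>x. \<Sum>a\<leftarrow>as. f a x) has_real_derivative (\<Sum>a\<leftarrow>as. D a)) F"
  using assms by (induction as) (auto intro!: derivative_intros)

text \<open>A primitive of the Coulson integrand \<open>ln (x\<^sup>2 + a\<^sup>2) / 2 - ln x\<close>.\<close>

definition log_primitive :: "real \<Rightarrow> real \<Rightarrow> real" where
  "log_primitive a x = x / 2 * ln (x\<^sup>2 + a\<^sup>2) - x * ln x + \<bar>a\<bar> * arctan (x / \<bar>a\<bar>)"

lemma log_primitive_DERIV: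
  assumes "x > 0"
  shows "(log_primitive a has_real_derivative ln (x\<^sup>2 + a\<^sup>2) / 2 - ln x) (at x)"
proof -
  have pos: "x\<^sup>2 + a\<^sup>2 > 0" using assms by (simp add: add_pos_nonneg)
  have "((\<lambda>x. x / 2 * ln (x\<^sup>2 + a\<^sup>2)) has_real_derivative
      ln (x\<^sup>2 + a\<^sup>2) / 2 + x\<^sup>2 / (x\<^sup>2 + a\<^sup>2)) (at x)"
    using pos by (auto intro!: derivative_eq_intros simp: power2_eq_square)
  moreover have "((\<lambda>x. x * ln x) has_real_derivative ln x + 1) (at x)"
    using assms by (auto intro!: derivative_eq_intros)
  moreover have "((\<lambda>x. \<bar>a\<bar> * arctan (x / \<bar>a\<bar>)) has_real_derivative a\<^sup>2 / (x\<^sup>2 + a\<^sup>2)) (at x)"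
  proof (cases "a = 0")
    case False
    then have 1: "1 + (x / \<bar>a\<bar>)\<^sup>2 = (x\<^sup>2 + a\<^sup>2) / a\<^sup>2"
      by (simp add: field_simps)
    have "((\<lambda>x. b * arctan (x / b)) has_real_derivative inverse (1 + (x / b)\<^sup>2)) (at x)"
      if "b \<noteq> 0" for b
      using that by (auto intro!: derivative_eq_intros)
    from this[of "\<bar>a\<bar>"] show ?thesis unfolding 1 using False by simp
  qed simp
  ultimately have "(log_primitive a has_real_derivative
      (ln (x\<^sup>2 + a\<^sup>2) / 2 + x\<^sup>2 / (x\<^sup>2 + a\<^sup>2)) - (ln x + 1) + a\<^sup>2 / (x\<^sup>2 + a\<^sup>2)) (at x)"
    unfolding log_primitive_def[abs_def] by (intro DERIV_add DERIV_diff)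
  \<comment> \<open>These two fractions add up to 1, which cancels the 1 in the derivative of
    \<open>x * ln x\<close>.\<close>
  moreover have "x\<^sup>2 / (x\<^sup>2 + a\<^sup>2) + a\<^sup>2 / (x\<^sup>2 + a\<^sup>2) = 1"
    unfolding add_divide_distrib[symmetric] by (rule divide_self) (use pos in linarith)
  then have "(ln (x\<^sup>2 + a\<^sup>2) / 2 + x\<^sup>2 / (x\<^sup>2 + a\<^sup>2)) - (ln x + 1) + a\<^sup>2 / (x\<^sup>2 + a\<^sup>2)
      = ln (x\<^sup>2 + a\<^sup>2) / 2 - ln x"
    by linarith
  ultimately show ?thesis by simp
qed

text \<open>For \<open>a = 0\<close> the two logarithmic terms cancel; otherwise
  \<open>ln (x^2 + a^2)\<close> stays bounded near 0 and \<open>x * ln x\<close> tends to 0.\<close>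

lemma log_primitive_at_0: "(log_primitive a \<longlongrightarrow> 0) (at_right 0)"
proof (cases "a = 0")
  case True
  then show ?thesis unfolding log_primitive_def[abs_def] by simp real_asymp
next
  case False
  then have "\<bar>a\<bar> > 0" by simp
  moreover define b where "b = \<bar>a\<bar>"
  ultimately have "b > 0" by simp
  then show ?thesis
    unfolding log_primitive_def[abs_def] b_def[symmetric] power2_abs[of a, symmetric] by real_asymp
qed

text \<open>The logarithmic terms combine to \<open>x / 2 * ln (1 + a^2 / x^2)\<close>, which tends
  to 0, so only the arctangent contributes.\<close>

lemma log_primitive_at_top: "(log_primitive a \<longlongrightarrow> \<bar>a\<bar> * (pi / 2)) at_top"
proof (cases "a = 0")
  case True
  then show ?thesis unfolding log_primitive_def[abs_def] by simp real_asymp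
next
  case False
  then have "\<bar>a\<bar> > 0" by simp
  moreover define b where "b = \<bar>a\<bar>"
  ultimately have "b > 0" by simp
  then show ?thesis
    unfolding log_primitive_def[abs_def] b_def[symmetric] power2_abs[of a, symmetric] by real_asymp
qed

text \<open>This is Coulson's comparison without an improper integral. The difference
  \<open>G\<close> of the summed primitives has as derivative half the logarithm of the quotient of
  the two products, since equal lengths cancel the \<open>ln x\<close> terms. So \<open>G\<close> is
  nondecreasing, with limit 0 at 0 and \<open>pi / 2\<close> times the difference of the two sums at
  infinity.\<close>

lemma sum_list_abs_mono:
  fixes as bs :: "real list"
  assumes len: "length as = length bs"
    and prod: "\<And>x. x > 0 \<Longrightarrow> (\<Prod>b\<leftarrow>bs. x\<^sup>2 + b\<^sup>2) \<le> (\<Prod>a\<leftarrow>as. x\<^sup>2 + a\<^sup>2)"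
  shows "(\<Sum>b\<leftarrow>bs. \<bar>b\<bar>) \<le> (\<Sum>a\<leftarrow>as. \<bar>a\<bar>)"
proof -
  define G where "G = (\<lambda>x. (\<Sum>a\<leftarrow>as. log_primitive a x) - (\<Sum>b\<leftarrow>bs. log_primitive b x))"
  have ln_prod: "ln (\<Prod>a\<leftarrow>cs. x\<^sup>2 + a\<^sup>2) = (\<Sum>a\<leftarrow>cs. ln (x\<^sup>2 + a\<^sup>2))"
    and prod_pos: "(\<Prod>a\<leftarrow>cs. x\<^sup>2 + a\<^sup>2) > 0" if "x > 0" for x :: real and cs
  proof -
    have pos: "x\<^sup>2 + a\<^sup>2 > 0" for a using that by (simp add: add_pos_nonneg)
    show prod_pos: "(\<Prod>a\<leftarrow>cs. x\<^sup>2 + a\<^sup>2) > 0" for cs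
      by (induction cs) (simp_all add: pos)
    show "ln (\<Prod>a\<leftarrow>cs. x\<^sup>2 + a\<^sup>2) = (\<Sum>a\<leftarrow>cs. ln (x\<^sup>2 + a\<^sup>2))"
      by (induction cs) (simp_all add: ln_mult_pos pos prod_pos)
  qed
  have deriv: "\<exists>D. (G has_real_derivative D) (at x) \<and> 0 \<le> D" if "x > 0" for x
  proof -
    have "(\<Sum>b\<leftarrow>bs. ln (x\<^sup>2 + b\<^sup>2)) \<le> (\<Sum>a\<leftarrow>as. ln (x\<^sup>2 + a\<^sup>2))"
      using prod[OF that] ln_prod[OF that] prod_pos[OF that]
      by (metis ln_le_cancel_iff)
    moreover have D: "((\<lambda>x. \<Sum>c\<leftarrow>cs. log_primitive c x) has_real_derivative
        (\<Sum>c\<leftarrow>cs. ln (x\<^sup>2 + c\<^sup>2)) / 2 - real (length cs) * ln x) (at x)" for cs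
    proof -
      have "(\<Sum>c\<leftarrow>cs. ln (x\<^sup>2 + c\<^sup>2) / 2 - ln x)
          = (\<Sum>c\<leftarrow>cs. ln (x\<^sup>2 + c\<^sup>2)) / 2 - real (length cs) * ln x"
        by (induction cs) (auto simp: field_simps)
      with sum_list_DERIV[of cs log_primitive "\<lambda>c. ln (x\<^sup>2 + c\<^sup>2) / 2 - ln x"] log_primitive_DERIV[OF that]
      show ?thesis by simp
    qed
    ultimately show ?thesis
      unfolding G_def using DERIV_diff[OF D[of as] D[of bs]] len by fastforce
  qed
  have mono: "G x \<le> G y" if "0 < x" "x \<le> y" for x y
    by (rule DERIV_nonneg_imp_nondecreasing[OF that(2)]) (use deriv that in auto)
  have "(G \<longlongrightarrow> (\<Sum>a\<leftarrow>as. 0) - (\<Sum>b\<leftarrow>bs. 0)) (at_right 0)"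
    unfolding G_def by (intro tendsto_diff sum_list_tendsto log_primitive_at_0)
  moreover have "\<forall>\<^sub>F x in at_right 0. G x \<le> G y" if "y > 0" for y
    using mono that by (auto simp: eventually_at_right_field intro!: exI[of _ y])
  ultimately have nonneg: "0 \<le> G y" if "y > 0" for y
    using tendsto_upperbound[of G 0 "at_right 0" "G y"] that by (simp add: sum_list_0)
  have "(G \<longlongrightarrow> (\<Sum>a\<leftarrow>as. \<bar>a\<bar> * (pi / 2)) - (\<Sum>b\<leftarrow>bs. \<bar>b\<bar> * (pi / 2))) at_top"
    unfolding G_def by (intro tendsto_diff sum_list_tendsto log_primitive_at_top)
  moreover have "\<forall>\<^sub>F x in at_top. 0 \<le> G x"
    using nonneg by (auto simp: eventually_at_top_linorder intro!: exI[of _ 1])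
  ultimately have "0 \<le> (\<Sum>a\<leftarrow>as. \<bar>a\<bar> * (pi / 2)) - (\<Sum>b\<leftarrow>bs. \<bar>b\<bar> * (pi / 2))"
    by (intro tendsto_lowerbound) auto
  then show ?thesis
    by (simp only: sum_list_mult_const diff_ge_0_iff_ge mult_le_cancel_right) simp
qed

subsection \<open>Characteristic polynomials of cycles\<close>

lemma adjacency_matrix_lessThan:
  assumes "pverts G = {..<n}"
  shows "adjacency_matrix G = Matrix.mat n n (\<lambda>(i, j). if (i, j) \<in> parcs G then 1 else 0)"
  unfolding adjacency_matrix_def assms lessThan_atLeast0
  by (intro eq_matI) (auto simp: Let_def)

text \<open>The polynomial z^n - 1 is monic and squarefree, and the numbers
  \<open>cis (2 * pi * k / n)\<close> enumerate its roots.\<close>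

lemma prod_roots_unity:
  fixes y :: complex
  assumes "n > 0"
  shows "(\<Prod>k<n. y - cis (2 * pi * real k / real n)) = y ^ n - 1"
proof -
  define p :: "complex poly" where "p = monom 1 n - 1"
  have p: "poly p z = z ^ n - 1" for z by (simp add: p_def poly_monom)
  have deg: "degree p = n"
    unfolding p_def using assms
    by (subst diff_conv_add_uminus, subst degree_add_eq_left) (auto simp: degree_monom_eq)
  have "rsquarefree p"
    unfolding rsquarefree_roots
    using assms by (auto simp: p_def pderiv_diff pderiv_monom poly_monom zero_power)
  moreover have "lead_coeff p = 1" using assms by (simp add: deg) (simp add: p_def)
  ultimately have "p = (\<Prod>z | z ^ n = 1. [:- z, 1:])"
    using complex_poly_decompose_rsquarefree[of p] by (simp add: p)
  then have "poly p y = (\<Prod>z | z ^ n = 1. y - z)"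
    by (simp add: poly_prod)
  also have "\<dots> = (\<Prod>k<n. y - cis (2 * pi * real k / real n))"
    using assms by (intro prod.reindex_bij_betw [symmetric] Complex.bij_betw_roots_unity) auto
  finally show ?thesis by (simp add: p)
qed

lemma power_mod_exponent:
  fixes w :: "'a :: monoid_mult"
  assumes "w ^ n = 1"
  shows "w ^ (m mod n) = w ^ m"
proof -
  have "w ^ m = w ^ (n * (m div n) + m mod n)" by simp
  also have "\<dots> = w ^ (m mod n)" unfolding power_add power_mult assms by simp
  finally show ?thesis by simp
qed

text \<open>The predecessor is written as \<open>(i + (n - 1)) mod n\<close>, so that powers of an
  n-th root of unity at both neighbours reduce by \<open>power_mod_exponent\<close>. From
  \<open>n = 3\<close> on the two neighbours differ.\<close>

lemma cycle_neighbours: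
  assumes "n \<ge> 3" "i < n"
  shows "{k. k < n \<and> (k = Suc i mod n \<or> i = Suc k mod n)} = {Suc i mod n, (i + (n - 1)) mod n}"
    and "Suc i mod n \<noteq> (i + (n - 1)) mod n"
proof -
  have 1: "(i + (n - 1)) mod n = (if i = 0 then n - 1 else i - 1)"
  proof (cases "i = 0")
    case False
    then have "i + (n - 1) = (i - 1) + n" using assms by simp
    then have "(i + (n - 1)) mod n = (i - 1) mod n" by (metis mod_add_self2)
    then show ?thesis using False assms by simp
  qed (use assms in simp)
  show "{k. k < n \<and> (k = Suc i mod n \<or> i = Suc k mod n)} = {Suc i mod n, (i + (n - 1)) mod n}"
    unfolding 1 using assms by (auto simp: mod_Suc split: if_splits)
  show "Suc i mod n \<noteq> (i + (n - 1)) mod n"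
    unfolding 1 using assms by (auto simp: mod_Suc split: if_splits)
qed

text \<open>The adjacency matrix is circulant, so the Fourier matrix \<open>F\<close> diagonalises
  it, with eigenvalues \<open>w k + inverse (w k)\<close>, that is, twice a cosine. \<open>Q\<close>
  is the inverse of \<open>F\<close>.\<close>

lemma char_poly_cycle_graph:
  assumes n: "n \<ge> 3"
  shows "char_poly (adjacency_matrix (cycle_graph n))
    = (\<Prod>r\<leftarrow>map (\<lambda>k. complex_of_real (2 * cos (2 * pi * real k / real n))) [0..<n]. [:- r, 1:])"
proof -
  define w where "w = (\<lambda>k. cis (2 * pi * real k / real n))"
  define A where "A = adjacency_matrix (cycle_graph n)"
  define F where "F = Matrix.mat n n (\<lambda>(i, j). w j ^ i)"
  define Q where "Q = Matrix.mat n n (\<lambda>(i, j). inverse (w i) ^ j / of_nat n)"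
  define D where "D = Matrix.mat n n (\<lambda>(i, j). if i = j then w i + inverse (w i) else 0)"
  have carrier: "A \<in> carrier_mat n n" "F \<in> carrier_mat n n" "Q \<in> carrier_mat n n"
      "D \<in> carrier_mat n n"
    unfolding F_def Q_def D_def A_def
    using adjacency_matrix_carrier[of "cycle_graph n"] by (auto simp: cycle_graph_def)
  have wn: "w k ^ n = 1" for k
    using n by (simp add: w_def Complex.DeMoivre cis_multiple_2pi)
  have w0: "w k \<noteq> 0" for k by (simp add: w_def)
  have inj: "w j \<noteq> w l" if "j < n" "l < n" "j \<noteq> l" for j l
    using bij_betw_imp_inj_on[OF Complex.bij_betw_roots_unity[of n]] n that
    unfolding inj_on_def w_def by auto
  \<comment> \<open>Orthogonality of characters: off the diagonal the entry is a geometric sum over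
    an n-th root of unity other than 1.\<close>
  have QF: "Q * F = 1\<^sub>m n"
  proof (rule eq_matI)
    fix j l assume jl: "j < dim_row (1\<^sub>m n :: complex mat)" "l < dim_col (1\<^sub>m n :: complex mat)"
    then have "(Q * F) $$ (j, l) = (\<Sum>i<n. (w l / w j) ^ i) / of_nat n"
      by (simp add: Q_def F_def scalar_prod_def lessThan_atLeast0 sum_distrib_left
          divide_inverse power_mult_distrib mult_ac)
    also have "\<dots> = (1\<^sub>m n :: complex mat) $$ (j, l)"
    proof (cases "j = l")
      case True
      then show ?thesis using jl n w0 by simp
    next
      case False
      then have "w l / w j \<noteq> 1" using inj[of j l] jl w0 by auto
      moreover have "(w l / w j) ^ n = 1" by (simp add: wn power_divide)
      ultimately have "(\<Sum>i<n. (w l / w j) ^ i) = 0" by (subst geometric_sum) simp_all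
      then show ?thesis using False jl by simp
    qed
    finally show "(Q * F) $$ (j, l) = 1\<^sub>m n $$ (j, l)" .
  qed (use carrier in auto)
  then have FQ: "F * Q = 1\<^sub>m n"
    using mat_mult_left_right_inverse carrier by blast
  have "A * F = F * D"
  proof (rule eq_matI)
    fix i j assume "i < dim_row (F * D)" "j < dim_col (F * D)"
    then have ij: "i < n" "j < n" using carrier by auto
    have "(A * F) $$ (i, j) = (\<Sum>k<n. if k = Suc i mod n \<or> i = Suc k mod n then w j ^ k else 0)"
      using ij unfolding A_def F_def
      by (subst adjacency_matrix_lessThan[of _ n])
        (auto simp: cycle_graph_def scalar_prod_def lessThan_atLeast0 intro!: sum.cong)
    also have "\<dots> = (\<Sum>k \<in> {k. k < n \<and> (k = Suc i mod n \<or> i = Suc k mod n)}. w j ^ k)"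
      by (subst sum.inter_filter [symmetric]) (auto intro!: sum.cong)
    also have "\<dots> = w j ^ Suc i + w j ^ (i + (n - 1))"
      unfolding cycle_neighbours(1)[OF n ij(1)]
      using cycle_neighbours(2)[OF n ij(1)] by (simp add: power_mod_exponent wn)
    also have "w j ^ (n - 1) = inverse (w j)"
      using wn[of j] w0[of j] n by (simp add: power_diff divide_inverse)
    then have "w j ^ Suc i + w j ^ (i + (n - 1)) = w j ^ i * (w j + inverse (w j))"
      by (simp add: power_add algebra_simps)
    also have "\<dots> = (F * D) $$ (i, j)"
      using ij by (simp add: F_def D_def scalar_prod_def lessThan_atLeast0
          if_distrib[of "\<lambda>x. _ * x"] cong: if_cong)
    finally show "(A * F) $$ (i, j) = (F * D) $$ (i, j)" .
  qed (use carrier in auto)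
  moreover have "A * F * Q = A"
    using carrier FQ by (simp add: assoc_mult_mat[of A n n F n Q n])
  ultimately have "A = F * D * Q" by simp
  then have "similar_mat A D"
    using carrier QF FQ by (intro similar_matI[of A D F Q n]) auto
  then have "char_poly A = char_poly D" by (rule char_poly_similar)
  also have "\<dots> = (\<Prod>a\<leftarrow>diag_mat D. [:- a, 1:])"
    by (rule char_poly_upper_triangular[OF carrier(4)]) (auto simp: upper_triangular_def D_def)
  also have "diag_mat D = map (\<lambda>k. complex_of_real (2 * cos (2 * pi * real k / real n))) [0..<n]"
    by (auto simp: diag_mat_def D_def w_def complex_eq_iff)
  finally show ?thesis unfolding A_def .
qed

text \<open>At \<open>y + 1 / y\<close> the factor of the k-th root splits as (y - w_k)(y -
  1/w_k)/y. Each of the two products over k equals y^n - 1, so the value is (y^n - 1)^2 /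
  y^n.\<close>

lemma poly_char_poly_cycle_graph:
  fixes y :: complex
  assumes n: "n \<ge> 3" and y: "y \<noteq> 0"
  shows "poly (char_poly (adjacency_matrix (cycle_graph n))) (y + 1 / y) = y ^ n + 1 / y ^ n - 2"
proof -
  define w where "w = (\<lambda>k. cis (2 * pi * real k / real n))"
  have fac: "y + 1 / y - complex_of_real (2 * cos (2 * pi * real k / real n))
      = (y - w k) * (1 / y) * (y - w (n - k))" if "k < n" for k
  proof -
    have "w (n - k) = cis (2 * pi - 2 * pi * real k / real n)"
      unfolding w_def using that n by (simp add: of_nat_diff diff_divide_distrib right_diff_distrib)
    then have c: "w (n - k) = cnj (w k)" by (simp add: w_def complex_eq_iff sin_diff cos_diff)
    have sum: "complex_of_real (2 * cos (2 * pi * real k / real n)) = w k + cnj (w k)"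
      by (simp add: w_def complex_eq_iff)
    have "w k * cnj (w k) = 1" by (simp add: w_def cis_cnj cis_mult)
    then show ?thesis
      unfolding c sum using y by (simp add: field_simps)
  qed
  have "poly (char_poly (adjacency_matrix (cycle_graph n))) (y + 1 / y)
      = (\<Prod>k<n. y + 1 / y - complex_of_real (2 * cos (2 * pi * real k / real n)))"
    unfolding char_poly_cycle_graph[OF n]
    by (simp add: poly_prod poly_prod_list o_def prod.list_conv_set_nth lessThan_atLeast0)
  also have "\<dots> = (\<Prod>k<n. (y - w k) * (1 / y) * (y - w (n - k)))"
    by (intro prod.cong refl fac) simp
  also have "\<dots> = (\<Prod>k<n. y - w k) * (1 / y) ^ n * (\<Prod>k<n. y - w (n - k))"
    by (simp only: prod.distrib prod_constant card_lessThan)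
  \<comment> \<open>Reversing the order lists \<open>w 1\<close> to \<open>w n\<close>; this is the
    full set of roots because \<open>w n = w 0\<close>.\<close>
  also have "(\<Prod>k<n. y - w (n - k)) = (\<Prod>k<n. y - w (Suc k))"
    by (rule prod.reindex_bij_witness[of _ "\<lambda>k. n - Suc k" "\<lambda>k. n - Suc k"])
      (auto simp: Suc_diff_Suc)
  also have "\<dots> = (\<Prod>k<n. y - w k)"
  proof -
    have "w n = w 0" using n by (simp add: w_def complex_eq_iff)
    moreover obtain m where m: "n = Suc m" using n by (cases n) auto
    ultimately show ?thesis
      unfolding m prod.lessThan_Suc_shift[of "\<lambda>k. y - w k"]
        prod.lessThan_Suc[of "\<lambda>k. y - w (Suc k)"] by simp
  qed
  also have "(\<Prod>k<n. y - w k) = y ^ n - 1"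
    unfolding w_def using n by (intro prod_roots_unity) simp
  finally show ?thesis using y by (simp add: field_simps power2_eq_square)
qed

subsection \<open>Characteristic polynomials by pendant deletion\<close>

text \<open>For an eigenvector v the form v^* A v equals k |v|^2 and is its own conjugate, while
  |v|^2 is positive.\<close>

lemma hermitian_root_char_poly_real:
  fixes A :: "complex mat"
  assumes A: "A \<in> carrier_mat n n"
    and herm: "\<And>i j. i < n \<Longrightarrow> j < n \<Longrightarrow> cnj (A $$ (i, j)) = A $$ (j, i)"
    and root: "poly (char_poly A) k = 0"
  shows "k \<in> \<real>"
proof -
  obtain v where "eigenvector A v k"
    using root eigenvalue_root_char_poly[OF A] unfolding eigenvalue_def by blast
  then have v: "v \<in> carrier_vec n" "v \<noteq> 0\<^sub>v n" "A *\<^sub>v v = k \<cdot>\<^sub>v v"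
    using A unfolding eigenvector_def by auto
  have row: "(\<Sum>j<n. A $$ (i, j) * v $ j) = k * v $ i" if "i < n" for i
  proof -
    have "(A *\<^sub>v v) $ i = k * v $ i" using v that by simp
    moreover have "(A *\<^sub>v v) $ i = (\<Sum>j<n. A $$ (i, j) * v $ j)"
      using A v(1) that by (simp add: scalar_prod_def lessThan_atLeast0)
    ultimately show ?thesis by simp
  qed
  define N where "N = (\<Sum>i<n. (cmod (v $ i))\<^sup>2)"
  obtain i0 where "i0 < n" "v $ i0 \<noteq> 0" using v(1,2) by (metis eq_vecI carrier_vecD index_zero_vec)
  then have "N > 0" unfolding N_def by (intro sum_pos2[of _ i0]) auto
  define S where "S = (\<Sum>i<n. \<Sum>j<n. cnj (v $ i) * A $$ (i, j) * v $ j)"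
  have "S = (\<Sum>i<n. cnj (v $ i) * (\<Sum>j<n. A $$ (i, j) * v $ j))"
    unfolding S_def by (simp add: sum_distrib_left mult_ac)
  also have "\<dots> = (\<Sum>i<n. k * (v $ i * cnj (v $ i)))"
    using row by (intro sum.cong) auto
  also have "\<dots> = k * complex_of_real N"
    unfolding N_def complex_norm_square[symmetric] by (simp add: sum_distrib_left)
  finally have S: "S = k * complex_of_real N" .
  have "cnj S = (\<Sum>i<n. \<Sum>j<n. cnj (v $ j) * A $$ (j, i) * v $ i)"
    unfolding S_def by (simp add: herm mult_ac)
  also have "\<dots> = S" unfolding S_def by (rule sum.swap)
  finally have "cnj k = k" using \<open>N > 0\<close> unfolding S by simp
  then show ?thesis by (simp add: Reals_cnj_iff)
qed

text \<open>Expand along the last row, which is supported in columns \<open>k\<close> and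
  \<open>Suc m\<close>, then expand the minor for column \<open>k\<close> along its last column,
  which is supported in row \<open>k\<close>. The map \<open>s\<close> enumerates the indices other
  than \<open>k\<close>.\<close>

lemma det_pendant:
  fixes g :: "nat \<Rightarrow> nat \<Rightarrow> 'a :: comm_ring_1"
  assumes k: "k \<le> m"
    and row: "\<And>j. j \<le> m \<Longrightarrow> j \<noteq> k \<Longrightarrow> g (Suc m) j = 0"
    and col: "\<And>i. i \<le> m \<Longrightarrow> i \<noteq> k \<Longrightarrow> g i (Suc m) = 0"
  defines "s \<equiv> \<lambda>i. if i < k then i else Suc i"
  shows "det (Matrix.mat (Suc (Suc m)) (Suc (Suc m)) (\<lambda>(i, j). g i j))
    = g (Suc m) (Suc m) * det (Matrix.mat (Suc m) (Suc m) (\<lambda>(i, j). g i j))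
      - g (Suc m) k * g k (Suc m) * det (Matrix.mat m m (\<lambda>(i, j). g (s i) (s j)))"
proof -
  define A where "A = Matrix.mat (Suc (Suc m)) (Suc (Suc m)) (\<lambda>(i, j). g i j)"
  define B where "B = mat_delete A (Suc m) k"
  \<comment> \<open>The cofactor signs of the two expansions are \<open>- e\<close> and
    \<open>e\<close>, so their product is -1.\<close>
  define e :: 'a where "e = (-1) ^ (k + m)"
  define D where "D = det (Matrix.mat m m (\<lambda>(i, j). g (s i) (s j)))"
  have ee: "e * e = 1" unfolding e_def by (rule minus_one_mult_self)
  have A: "A \<in> carrier_mat (Suc (Suc m)) (Suc (Suc m))" by (simp add: A_def)
  have B: "B \<in> carrier_mat (Suc m) (Suc m)" using mat_delete_carrier[OF A] by (simp add: B_def)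
  have B_col: "B $$ (i, m) = g i (Suc m)" if "i < Suc m" for i
    using that k by (auto simp: B_def mat_delete_def A_def)
  have "det B = (\<Sum>i<Suc m. B $$ (i, m) * cofactor B i m)"
    by (rule laplace_expansion_column[OF B]) simp
  also have "\<dots> = (\<Sum>i<Suc m. if i = k then g k (Suc m) * cofactor B k m else 0)"
    by (rule sum.cong) (auto simp: B_col col)
  also have "\<dots> = g k (Suc m) * ((-1) ^ (k + m) * det (mat_delete B k m))"
    using k by (simp add: cofactor_def)
  also have "mat_delete B k m = Matrix.mat m m (\<lambda>(i, j). g (s i) (s j))"
    using k by (intro eq_matI) (auto simp: B_def A_def mat_delete_def s_def)
  finally have det_B: "det B = g k (Suc m) * (e * D)"
    unfolding e_def D_def .
  have "det A = (\<Sum>j<Suc (Suc m). A $$ (Suc m, j) * cofactor A (Suc m) j)"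
    by (rule laplace_expansion_row[OF A]) simp
  also have "\<dots> = (\<Sum>j<Suc m. A $$ (Suc m, j) * cofactor A (Suc m) j)
      + g (Suc m) (Suc m) * cofactor A (Suc m) (Suc m)"
    by (simp add: A_def)
  also have "(\<Sum>j<Suc m. A $$ (Suc m, j) * cofactor A (Suc m) j)
      = (\<Sum>j<Suc m. if j = k then g (Suc m) k * cofactor A (Suc m) k else 0)"
    by (rule sum.cong) (auto simp: A_def row)
  also have "\<dots> = g (Suc m) k * ((- e) * det B)"
    using k by (simp add: cofactor_def B_def e_def add.commute)
  also have "cofactor A (Suc m) (Suc m) = det (Matrix.mat (Suc m) (Suc m) (\<lambda>(i, j). g i j))"
  proof -
    have "mat_delete A (Suc m) (Suc m) = Matrix.mat (Suc m) (Suc m) (\<lambda>(i, j). g i j)"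
      by (intro eq_matI) (auto simp: A_def mat_delete_def)
    then show ?thesis by (simp add: cofactor_def power_add)
  qed
  also have "(- e) * det B = - (g k (Suc m) * D)"
    unfolding det_B using ee by (metis minus_mult_left mult.left_commute mult.assoc mult_1)
  finally show ?thesis unfolding A_def D_def by (simp only: mult_minus_right) simp
qed

text \<open>The characteristic polynomial evaluated at \<open>z\<close>, for the graph that the
  relation \<open>E\<close> induces on the numbers below \<open>n\<close>. Deleting vertices then
  amounts to relabelling \<open>E\<close> or lowering \<open>n\<close>.\<close>

definition char_det :: "(nat \<Rightarrow> nat \<Rightarrow> bool) \<Rightarrow> nat \<Rightarrow> 'a \<Rightarrow> 'a :: comm_ring_1" where
  "char_det E n z = det (Matrix.mat n n
    (\<lambda>(i, j). (if i = j then z else 0) - (if E i j then 1 else 0)))"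

lemma char_det_cong:
  assumes "\<And>i j. i < n \<Longrightarrow> j < n \<Longrightarrow> E i j \<longleftrightarrow> E' i j"
  shows "char_det E n z = char_det E' n z"
  unfolding char_det_def by (rule arg_cong[of _ _ det]) (auto simp: assms)

lemma poly_char_poly_adjacency_matrix:
  assumes "pverts G = {..<n}"
  shows "poly (char_poly (adjacency_matrix G)) z = char_det (\<lambda>i j. (i, j) \<in> parcs G) n z"
proof -
  have "adjacency_matrix G \<in> carrier_mat n n"
    using adjacency_matrix_carrier[of G] assms by simp
  then show ?thesis
    unfolding char_poly_def char_det_def
    by (intro poly_det_cong[of _ n])
      (auto simp: char_poly_matrix_def adjacency_matrix_def assms lessThan_atLeast0 Let_def)
qed

text \<open>The classical rule phi(G) = z phi(G - v) - phi(G - v - u) for a vertex v whose only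
  neighbour is u; here v is \<open>Suc m\<close> and u is \<open>k\<close>.\<close>

lemma char_det_pendant:
  assumes k: "k \<le> m"
    and E: "\<And>j. j \<le> m \<Longrightarrow> E (Suc m) j \<longleftrightarrow> j = k" "\<And>i. i \<le> m \<Longrightarrow> E i (Suc m) \<longleftrightarrow> i = k"
      "\<not> E (Suc m) (Suc m)"
  defines "s \<equiv> \<lambda>i. if i < k then i else Suc i"
  shows "char_det E (Suc (Suc m)) z
    = z * char_det E (Suc m) z - char_det (\<lambda>i j. E (s i) (s j)) m z"
proof -
  \<comment> \<open>Injectivity turns the diagonal condition \<open>s i = s j\<close> into
    \<open>i = j\<close>, so the last minor is again a \<open>char_det\<close>.\<close>
  have "inj s" unfolding s_def by (rule injI) (auto split: if_splits)
  then have "Matrix.mat m m (\<lambda>(i, j). (if s i = s j then z else 0) - (if E (s i) (s j) then 1 else 0))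
      = Matrix.mat m m (\<lambda>(i, j). (if i = j then z else 0) - (if E (s i) (s j) then 1 else 0))"
    by (simp add: inj_eq)
  moreover have "det (Matrix.mat (Suc (Suc m)) (Suc (Suc m))
      (\<lambda>(i, j). (if i = j then z else 0) - (if E i j then 1 else 0)))
    = z * det (Matrix.mat (Suc m) (Suc m)
        (\<lambda>(i, j). (if i = j then z else 0) - (if E i j then 1 else 0)))
      - det (Matrix.mat m m
        (\<lambda>(i, j). (if s i = s j then z else 0) - (if E (s i) (s j) then 1 else 0)))"
    unfolding s_def
    by (subst det_pendant[of k m "\<lambda>i j. (if i = j then z else 0) - (if E i j then 1 else 0)"])
      (use k E in auto)
  ultimately show ?thesis unfolding char_det_def by simp
qed

section \<open>Recursions for the path and for the hexagon with a tail\<close>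

definition path_edge :: "nat \<Rightarrow> nat \<Rightarrow> bool" where
  "path_edge i j \<longleftrightarrow> j = Suc i \<or> i = Suc j"

lemma char_det_path_0: "char_det path_edge 0 z = 1"
  by (simp add: char_det_def)

lemma char_det_path_1: "char_det path_edge (Suc 0) z = z"
  unfolding char_det_def by (subst det_single) (auto simp: path_edge_def)

lemma char_det_path_Suc_Suc:
  "char_det path_edge (Suc (Suc m)) z = z * char_det path_edge (Suc m) z - char_det path_edge m z"
  by (subst char_det_pendant[of m])
    (auto simp: path_edge_def intro!: arg_cong2[of _ _ _ _ "(-)"] char_det_cong)

lemma char_det_path_5: "char_det path_edge 5 (z :: complex) = z ^ 5 - 4 * z ^ 3 + 3 * z"
proof -
  have "char_det path_edge (Suc (Suc (Suc (Suc (Suc 0))))) z = z ^ 5 - 4 * z ^ 3 + 3 * z"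
    unfolding char_det_path_Suc_Suc char_det_path_0 char_det_path_1
    by (simp add: algebra_simps power_numeral_reduce)
  then show ?thesis by (simp add: numeral_eq_Suc)
qed

text \<open>A single relation for all orders: a hexagon with an infinite tail at 0. Its restriction
  to the numbers below \<open>n\<close> is the hexagon for \<open>n = 6\<close> and P_n^6 for
  \<open>n \<ge> 7\<close>, so the recursion in \<open>n\<close> can start at 6.\<close>

definition P6_edge :: "nat \<Rightarrow> nat \<Rightarrow> bool" where
  "P6_edge i j \<longleftrightarrow>
    (if i < 6 \<and> j < 6 then j = Suc i mod 6 \<or> i = Suc j mod 6
     else if i < 6 \<or> j < 6 then (i, j) = (0, 6) \<or> (i, j) = (6, 0)
     else path_edge i j)"

lemma P6_graph_edge:
  assumes "n \<ge> 7" "i < n" "j < n"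
  shows "(i, j) \<in> parcs (P6_graph n) \<longleftrightarrow> P6_edge i j"
proof -
  have "(i, j) \<in> map_prod (\<lambda>i. i + 6) (\<lambda>i. i + 6) ` parcs (path_graph (n - 6))
      \<longleftrightarrow> 6 \<le> i \<and> 6 \<le> j \<and> path_edge i j"
  proof
    assume "6 \<le> i \<and> 6 \<le> j \<and> path_edge i j"
    then show "(i, j) \<in> map_prod (\<lambda>i. i + 6) (\<lambda>i. i + 6) ` parcs (path_graph (n - 6))"
      using assms by (intro image_eqI[of _ _ "(i - 6, j - 6)"])
        (auto simp: path_graph_def path_edge_def)
  qed (auto simp: path_graph_def path_edge_def)
  then have "(i, j) \<in> parcs (P6_graph n) \<longleftrightarrow>
      i < 6 \<and> j < 6 \<and> (j = Suc i mod 6 \<or> i = Suc j mod 6) \<or>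
      6 \<le> i \<and> 6 \<le> j \<and> path_edge i j \<or> (i, j) = (0, 6) \<or> (i, j) = (6, 0)"
    by (simp add: P6_graph_def cycle_graph_def) blast
  then show ?thesis
    unfolding P6_edge_def by (cases "i < 6"; cases "j < 6"; simp; linarith?)
qed

text \<open>The tail vertex 6 is pendant at 0; removing both leaves the path on 1, ..., 5, whose
  characteristic polynomial is subtracted.\<close>

lemma char_det_P6_7:
  fixes z :: complex
  shows "char_det P6_edge 7 z = z * char_det P6_edge 6 z - (z ^ 5 - 4 * z ^ 3 + 3 * z)"
proof -
  have "char_det P6_edge (Suc (Suc 5)) z = z * char_det P6_edge (Suc 5) z
      - char_det (\<lambda>i j. P6_edge (if i < 0 then i else Suc i) (if j < 0 then j else Suc j)) 5 z"
    by (rule char_det_pendant) (auto simp: P6_edge_def path_edge_def)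
  also have "char_det (\<lambda>i j. P6_edge (if i < 0 then i else Suc i) (if j < 0 then j else Suc j)) 5 z
      = char_det path_edge 5 z"
  proof (rule char_det_cong)
    \<comment> \<open>After the shift by one, the cyclic successor wraps only from vertex 5 to the
      deleted vertex 0.\<close>
    have succ: "Suc (Suc i) mod 6 = (if i = 4 then 0 else Suc (Suc i))" if "i < 5" for i :: nat
      using that by auto
    show "P6_edge (if i < 0 then i else Suc i) (if j < 0 then j else Suc j) \<longleftrightarrow> path_edge i j"
      if "i < 5" "j < 5" for i j
      using that by (simp add: P6_edge_def path_edge_def succ)
  qed
  finally show ?thesis by (simp add: char_det_path_5)
qed

text \<open>From \<open>m = 6\<close> on, \<open>Suc m\<close> is pendant at the tail vertex
  \<open>m\<close>, and deleting both leaves the same graph on \<open>m\<close> vertices.\<close>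

lemma char_det_P6_Suc_Suc:
  assumes "m \<ge> 6"
  shows "char_det P6_edge (Suc (Suc m)) z = z * char_det P6_edge (Suc m) z - char_det P6_edge m z"
proof -
  have "char_det P6_edge (Suc (Suc m)) z = z * char_det P6_edge (Suc m) z
      - char_det (\<lambda>i j. P6_edge (if i < m then i else Suc i) (if j < m then j else Suc j)) m z"
    using assms by (intro char_det_pendant) (auto simp: P6_edge_def path_edge_def)
  also have "char_det (\<lambda>i j. P6_edge (if i < m then i else Suc i) (if j < m then j else Suc j)) m z
      = char_det P6_edge m z"
    by (rule char_det_cong) auto
  finally show ?thesis .
qed

lemma poly_char_poly_P6_graph:
  assumes "n \<ge> 7"
  shows "poly (char_poly (adjacency_matrix (P6_graph n))) z = char_det P6_edge n z"
  unfolding poly_char_poly_adjacency_matrix[OF pverts_P6_graph[OF assms]]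
  by (rule char_det_cong) (rule P6_graph_edge[OF assms])

lemma char_det_P6_6:
  "char_det P6_edge 6 z = poly (char_poly (adjacency_matrix (cycle_graph 6))) z"
proof -
  have "pverts (cycle_graph 6) = {..<6}" by (simp add: cycle_graph_def)
  from poly_char_poly_adjacency_matrix[OF this, of z]
  have "poly (char_poly (adjacency_matrix (cycle_graph 6))) z
      = char_det (\<lambda>i j. (i, j) \<in> parcs (cycle_graph 6)) 6 z" .
  also have "\<dots> = char_det P6_edge 6 z"
    by (rule char_det_cong) (simp add: cycle_graph_def P6_edge_def)
  finally show ?thesis by simp
qed

subsection \<open>Monotonicity of the energy difference\<close>

definition real_rooted :: "complex poly \<Rightarrow> real list \<Rightarrow> bool" where
  "real_rooted p rs \<longleftrightarrow> p = (\<Prod>r\<leftarrow>map complex_of_real rs. [:- r, 1:])"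

lemma real_rooted_char_poly_adjacency_matrix:
  assumes V: "pverts G = {..<n}"
    and sym: "\<And>u v. (u, v) \<in> parcs G \<Longrightarrow> (v, u) \<in> parcs G"
  obtains rs where "length rs = n" "real_rooted (char_poly (adjacency_matrix G)) rs"
proof -
  define A where "A = adjacency_matrix G"
  have A: "A \<in> carrier_mat n n"
    unfolding A_def using adjacency_matrix_carrier[of G] V by simp
  obtain as where as: "char_poly A = (\<Prod>a\<leftarrow>as. [:- a, 1:])" "length as = n"
    using char_poly_factorized[OF A] by blast
  have "a \<in> \<real>" if "a \<in> set as" for a
  proof (rule hermitian_root_char_poly_real[OF A])
    show "poly (char_poly A) a = 0"
      unfolding as using that by (auto simp: poly_prod_list prod_list_zero_iff)
    show "cnj (A $$ (i, j)) = A $$ (j, i)" if "i < n" "j < n" for i j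
      using that sym unfolding A_def adjacency_matrix_lessThan[OF V] by auto
  qed
  then have "map complex_of_real (map Re as) = as"
    by (auto intro!: map_idI simp: o_def)
  then have "real_rooted (char_poly A) (map Re as)"
    unfolding real_rooted_def as by simp
  with that[of "map Re as"] as(2) show ?thesis unfolding A_def by simp
qed

lemma graph_energy_real_rooted:
  assumes "real_rooted (char_poly (adjacency_matrix G)) rs"
  shows "graph_energy G = (\<Sum>r\<leftarrow>rs. \<bar>r\<bar>)"
  using graph_energy_eq_sum_list[OF assms[unfolded real_rooted_def]] by (simp add: o_def)

text \<open>For real r, |ix - r|^2 = x^2 + r^2; this links the modulus to the products in
  \<open>sum_list_abs_mono\<close>.\<close>

lemma cmod_poly_real_rooted:
  assumes "real_rooted p rs"
  shows "(cmod (poly p (\<i> * complex_of_real x)))\<^sup>2 = (\<Prod>r\<leftarrow>rs. x\<^sup>2 + r\<^sup>2)"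
  unfolding assms[unfolded real_rooted_def]
proof (induction rs)
  case (Cons r rs)
  have "(cmod (\<i> * complex_of_real x - complex_of_real r))\<^sup>2 = x\<^sup>2 + r\<^sup>2"
    by (simp add: cmod_power2)
  moreover have "poly (\<Prod>r\<leftarrow>map complex_of_real (r # rs). [:- r, 1:]) w
      = (w - complex_of_real r) * poly (\<Prod>r\<leftarrow>map complex_of_real rs. [:- r, 1:]) w" for w
    by (simp add: algebra_simps)
  ultimately show ?case
    using Cons by (simp only: norm_mult power_mult_distrib list.map prod_list.Cons)
qed simp

text \<open>Taking two graphs on each side makes different orders comparable: both concatenated
  lists of roots have length \<open>n + m\<close>.\<close>

lemma energy_sum_mono:
  assumes G1: "real_rooted (char_poly (adjacency_matrix G1)) r1" "length r1 = n"
    and G2: "real_rooted (char_poly (adjacency_matrix G2)) r2" "length r2 = m"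
    and H1: "real_rooted (char_poly (adjacency_matrix H1)) s1" "length s1 = n"
    and H2: "real_rooted (char_poly (adjacency_matrix H2)) s2" "length s2 = m"
    and le: "\<And>x. x > 0 \<Longrightarrow>
      cmod (poly (char_poly (adjacency_matrix H1)) (\<i> * complex_of_real x)) *
      cmod (poly (char_poly (adjacency_matrix H2)) (\<i> * complex_of_real x)) \<le>
      cmod (poly (char_poly (adjacency_matrix G1)) (\<i> * complex_of_real x)) *
      cmod (poly (char_poly (adjacency_matrix G2)) (\<i> * complex_of_real x))"
  shows "graph_energy H1 + graph_energy H2 \<le> graph_energy G1 + graph_energy G2"
proof -
  have "(\<Sum>s\<leftarrow>s1 @ s2. \<bar>s\<bar>) \<le> (\<Sum>r\<leftarrow>r1 @ r2. \<bar>r\<bar>)"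
  proof (rule sum_list_abs_mono)
    fix x :: real assume "x > 0"
    from power_mono[OF le[OF this], of 2]
    show "(\<Prod>s\<leftarrow>s1 @ s2. x\<^sup>2 + s\<^sup>2) \<le> (\<Prod>r\<leftarrow>r1 @ r2. x\<^sup>2 + r\<^sup>2)"
      by (simp add: power_mult_distrib cmod_poly_real_rooted[OF G1(1)]
          cmod_poly_real_rooted[OF G2(1)] cmod_poly_real_rooted[OF H1(1)]
          cmod_poly_real_rooted[OF H2(1)])
  qed (simp add: G1 G2 H1 H2)
  then show ?thesis
    by (simp add: graph_energy_real_rooted[OF G1(1)] graph_energy_real_rooted[OF G2(1)]
        graph_energy_real_rooted[OF H1(1)] graph_energy_real_rooted[OF H2(1)])
qed

lemma P6_graph_real_rooted:
  assumes "n \<ge> 7"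
  obtains rs where "length rs = n" "real_rooted (char_poly (adjacency_matrix (P6_graph n))) rs"
proof -
  interpret pair_graph "P6_graph n" by (rule pair_graph_P6_graph[OF assms])
  show ?thesis
    by (rule real_rooted_char_poly_adjacency_matrix[OF pverts_P6_graph[OF assms] _ that])
      (rule arcs_symmetric)
qed

lemma cycle_graph_real_rooted:
  assumes "n \<ge> 3"
  shows "real_rooted (char_poly (adjacency_matrix (cycle_graph n)))
    (map (\<lambda>k. 2 * cos (2 * pi * real k / real n)) [0..<n])"
  unfolding real_rooted_def char_poly_cycle_graph[OF assms] by (simp add: o_def)

section \<open>Closed forms on the imaginary axis\<close>

lemma imaginary_axis_substitution:
  fixes Y :: real
  assumes "Y \<noteq> 0"
  shows "\<i> * complex_of_real Y + 1 / (\<i> * complex_of_real Y) = \<i> * complex_of_real (Y - 1 / Y)"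
  using assms by (simp add: complex_eq_iff Re_divide Im_divide)

abbreviation cmod_char_poly :: "nat pair_pre_digraph \<Rightarrow> real \<Rightarrow> real" where
  "cmod_char_poly G Y \<equiv>
    cmod (poly (char_poly (adjacency_matrix G)) (\<i> * complex_of_real (Y - 1 / Y)))"

text \<open>With \<open>z = Y ^ n\<close> the value is i^n z + 1/(i^n z) - 2. For even
  \<open>n\<close> it is real of known sign. For odd \<open>n\<close> its real part is -2 and its
  imaginary part is z - 1/z up to sign, and (z - 1/z)^2 + 4 = (z + 1/z)^2.\<close>

lemma cmod_cycle_graph:
  fixes Y :: real
  assumes n: "n \<ge> 3" and Y: "Y > 1"
  defines "v \<equiv> cmod_char_poly (cycle_graph n) Y"
  shows "n mod 4 = 0 \<Longrightarrow> v = Y ^ n + 1 / Y ^ n - 2"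
    and "n mod 4 = 2 \<Longrightarrow> v = Y ^ n + 1 / Y ^ n + 2"
    and "odd n \<Longrightarrow> v = Y ^ n + 1 / Y ^ n"
proof -
  define z where "z = Y ^ n"
  have z: "z > 1" unfolding z_def using Y n by (intro one_less_power) auto
  have in4: "\<i> ^ n = \<i> ^ (n mod 4)"
    by (rule power_mod_exponent[symmetric]) (simp add: power4_eq_xxxx)
  have v: "v = cmod (\<i> ^ n * complex_of_real z + 1 / (\<i> ^ n * complex_of_real z) - 2)"
    unfolding v_def z_def using Y
    by (simp only: imaginary_axis_substitution[symmetric] order.strict_implies_not_eq less_trans[OF zero_less_one])
      (subst poly_char_poly_cycle_graph[OF n], auto simp: power_mult_distrib)
  have pos: "z + 1 / z - 2 = (z - 1)\<^sup>2 / z"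
    using z by (simp add: field_simps power2_eq_square)
  {
    assume "n mod 4 = 0"
    then have "v = cmod (complex_of_real (z + 1 / z - 2))" unfolding v in4 by simp
    also have "\<dots> = z + 1 / z - 2"
      unfolding norm_of_real pos using z by simp
    finally show "v = Y ^ n + 1 / Y ^ n - 2" unfolding z_def .
  next
    assume "n mod 4 = 2"
    then have "v = cmod (complex_of_real (- (z + 1 / z + 2)))" unfolding v in4 by simp
    also have "\<dots> = z + 1 / z + 2"
      unfolding norm_of_real abs_minus_cancel by (rule abs_of_nonneg) (use z in simp)
    finally show "v = Y ^ n + 1 / Y ^ n + 2" unfolding z_def .
  next
    assume "odd n"
    then have "n mod 4 = 1 \<or> n mod 4 = 3" by presburger
    then have "v\<^sup>2 = (z - 1 / z)\<^sup>2 + 4"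
    proof
      assume "n mod 4 = 1"
      then have "v = cmod (Complex (- 2) (z - 1 / z))"
        unfolding v in4 using z
        by (intro arg_cong[of _ _ cmod]) (simp add: complex_eq_iff Re_divide Im_divide power2_eq_square)
      then show ?thesis by (simp add: cmod_power2)
    next
      assume "n mod 4 = 3"
      then have "v = cmod (Complex (- 2) (1 / z - z))"
        unfolding v in4 using z
        by (intro arg_cong[of _ _ cmod])
          (simp add: complex_eq_iff Re_divide Im_divide power2_eq_square power3_eq_cube)
      then show ?thesis by (simp add: cmod_power2 power2_commute)
    qed
    also have "\<dots> = (z + 1 / z)\<^sup>2"
      using z by (simp add: field_simps power2_eq_square)
    finally have "v = z + 1 / z"
      by (rule power2_eq_imp_eq) (use z in \<open>auto simp: v_def\<close>)
    then show "v = Y ^ n + 1 / Y ^ n" unfolding z_def .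
  }
qed

lemma two_step_induct [consumes 1, case_names base base_Suc step]:
  fixes m :: nat
  assumes "m \<le> n" "P m" "P (Suc m)"
    and "\<And>k. m \<le> k \<Longrightarrow> P k \<Longrightarrow> P (Suc k) \<Longrightarrow> P (Suc (Suc k))"
  shows "P n"
proof -
  have "P n \<and> P (Suc n)" using assms(1) by (induction rule: dec_induct) (use assms in auto)
  then show ?thesis ..
qed

text \<open>At ix the pendant recursion becomes \<open>d (n + 2) = x * d (n + 1) + d n\<close> after
  a factor i^n is removed. Its characteristic roots are \<open>Y\<close> and \<open>- 1 / Y\<close>,
  and \<open>A\<close>, \<open>B\<close> fit the values at 6 and 7. The bound on \<open>B\<close>
  also makes \<open>d n\<close> nonnegative, so no absolute value remains.\<close>

lemma cmod_P6_graph: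
  fixes Y :: real
  assumes Y: "Y > 1"
  obtains A B where "0 \<le> B" "B \<le> A * Y ^ 10"
    "\<And>n. n \<ge> 7 \<Longrightarrow>
      cmod_char_poly (P6_graph n) Y
        = A * Y ^ n + B * (- 1 / Y) ^ n"
proof -
  define u x where "u = 1 / Y" and "x = Y - u"
  have Yu: "Y * u = 1" and u: "0 < u" "u < 1" using Y by (auto simp: u_def)
  \<comment> \<open>These are the moduli at ix of the characteristic polynomials of C_6 and
    P_5.\<close>
  define d6 q where "d6 = Y ^ 6 + u ^ 6 + 2" and "q = x ^ 5 + 4 * x ^ 3 + 3 * x"
  \<comment> \<open>The solution of \<open>A * Y ^ 6 + B * u ^ 6 = d6\<close> and
    \<open>A * Y ^ 7 - B * u ^ 7 = x * d6 + q\<close>.\<close>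
  define A B where "A = u ^ 6 * (Y * d6 + q) / (Y + u)" and "B = Y ^ 6 * (u * d6 - q) / (Y + u)"
  define d where "d = (\<lambda>n. A * Y ^ n + B * (- u) ^ n)"
  have "(Y + u) * A = u ^ 6 * (Y * d6 + q)" "(Y + u) * B = Y ^ 6 * (u * d6 - q)"
    using Y u by (simp_all add: A_def B_def)
  then have d: "(Y + u) * d n = u ^ 6 * (Y * d6 + q) * Y ^ n + Y ^ 6 * (u * d6 - q) * (- u) ^ n" for n
    unfolding d_def distrib_left mult.assoc[symmetric] by simp
  have Yu6: "Y ^ 6 * u ^ 6 = 1" using Yu by (metis power_mult_distrib power_one)
  have "(Y + u) * d 6 = (Y ^ 6 * u ^ 6) * (Y * d6 + q) + (Y ^ 6 * u ^ 6) * (u * d6 - q)"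
    unfolding d by (simp add: mult_ac)
  then have "(Y + u) * d 6 = (Y + u) * d6" unfolding Yu6 by (simp add: algebra_simps)
  then have d_6: "d 6 = d6" using Y u by simp
  have "Y ^ 7 = Y * Y ^ 6" "(- u) ^ 7 = - (u * u ^ 6)" by (simp_all add: eval_nat_numeral)
  then have "(Y + u) * d 7 = Y * (Y ^ 6 * u ^ 6) * (Y * d6 + q) - u * (Y ^ 6 * u ^ 6) * (u * d6 - q)"
    unfolding d by (simp add: mult_ac)
  then have "(Y + u) * d 7 = (Y + u) * (x * d6 + q)"
    unfolding Yu6 x_def by (simp add: algebra_simps)
  then have d_7: "d 7 = x * d6 + q" using Y u by simp
  have d_step: "d (Suc (Suc n)) = x * d (Suc n) + d n" for n
  proof -
    have "w ^ Suc (Suc n) = x * w ^ Suc n + w ^ n" if "w * w = x * w + 1" for w :: real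
    proof -
      have "w ^ Suc (Suc n) = (w * w) * w ^ n" by simp
      also have "\<dots> = x * w ^ Suc n + w ^ n" unfolding that by (simp add: algebra_simps)
      finally show ?thesis .
    qed
    from this[of Y] this[of "- u"]
    have "Y ^ Suc (Suc n) = x * Y ^ Suc n + Y ^ n"
        "(- u) ^ Suc (Suc n) = x * (- u) ^ Suc n + (- u) ^ n"
      using Yu by (auto simp: x_def algebra_simps)
    then have "d (Suc (Suc n)) = A * (x * Y ^ Suc n + Y ^ n) + B * (x * (- u) ^ Suc n + (- u) ^ n)"
      by (simp only: d_def)
    also have "\<dots> = x * d (Suc n) + d n" unfolding d_def by (simp add: algebra_simps)
    finally show ?thesis .
  qed
  define z where "z = \<i> * complex_of_real x"
  have i3: "\<i> ^ 3 = - \<i>" and i5: "\<i> ^ 5 = \<i>" by (simp_all add: eval_nat_numeral)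
  have i6: "\<i> ^ 6 = (-1 :: complex)" and i7: "\<i> ^ 7 = - \<i>" by (simp_all add: eval_nat_numeral)
  have "z = \<i> * complex_of_real Y + 1 / (\<i> * complex_of_real Y)"
    using imaginary_axis_substitution[of Y] Y by (simp add: z_def x_def u_def)
  then have "char_det P6_edge 6 z
      = (\<i> * complex_of_real Y) ^ 6 + 1 / (\<i> * complex_of_real Y) ^ 6 - 2"
    unfolding char_det_P6_6 using Y poly_char_poly_cycle_graph[of 6] by simp
  also have "\<dots> = - complex_of_real d6"
    using Y i6 by (simp add: d6_def u_def power_mult_distrib power_divide)
  finally have D6: "char_det P6_edge 6 z = - complex_of_real d6" .
  have z35: "z ^ 3 = - (\<i> * complex_of_real (x ^ 3))" "z ^ 5 = \<i> * complex_of_real (x ^ 5)"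
    unfolding z_def power_mult_distrib i3 i5 by simp_all
  have D7: "char_det P6_edge 7 z = - (\<i> * complex_of_real (x * d6 + q))"
    unfolding char_det_P6_7 D6 z35 unfolding q_def z_def by (simp add: algebra_simps)
  have D: "char_det P6_edge n z = \<i> ^ n * complex_of_real (d n)" if "6 \<le> n" for n
    using that
  proof (induction rule: two_step_induct)
    case base
    show ?case unfolding D6 d_6 i6 by simp
  next
    case base_Suc
    have "Suc 6 = 7" by simp
    then show ?case by (simp only: D7 d_7 i7) simp
  next
    case (step k)
    then show ?case
      by (simp add: char_det_P6_Suc_Suc d_step z_def algebra_simps)
  qed
  have Y6u: "Y ^ 6 * u = Y ^ 5" using Yu by (simp add: eval_nat_numeral mult.assoc)
  have d6_nonneg: "d6 \<ge> 0" using Y u by (simp add: d6_def)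
  \<comment> \<open>Written in powers of \<open>Y\<close> and \<open>u\<close>, the leading
    \<open>Y ^ 5\<close> cancels, and every remaining term is nonnegative because
    \<open>Y > 1 > u\<close>. This gives \<open>B \<ge> 0\<close>.\<close>
  have "u * d6 - q = Y * (Y\<^sup>2 - 1) + 2 * u + u * (1 - u\<^sup>2) + u ^ 5 + u ^ 7"
  proof -
    have "Y ^ 3 - u ^ 3 = x ^ 3 + 3 * (Y * u) * x"
      "Y ^ 5 - u ^ 5 = x ^ 5 + 5 * (Y * u) * x ^ 3 + 5 * (Y * u) * (Y * u) * x"
      by (simp_all add: x_def algebra_simps power_numeral_reduce)
    then have "q = Y ^ 5 - u ^ 5 - (Y ^ 3 - u ^ 3) + x" unfolding Yu q_def by simp
    then show ?thesis
      using Y6u by (simp add: d6_def x_def algebra_simps eval_nat_numeral)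
  qed
  moreover have "Y\<^sup>2 \<ge> 1" "u\<^sup>2 \<le> 1" using Y u by (auto simp: power_le_one)
  ultimately have B0: "0 \<le> u * d6 - q" using Y u by simp
  have x0: "x \<ge> 0" using Y u by (simp add: x_def)
  then have q0: "q \<ge> 0" by (simp add: q_def)
  show thesis
  proof (rule that)
    show B: "0 \<le> B" using B0 Y u by (simp add: B_def)
    \<comment> \<open>Dropping \<open>q\<close> enlarges the left side and shrinks the right one;
      what remains is \<open>Y ^ 5 * d6\<close> on both sides.\<close>
    have "Y ^ 6 * (u * d6 - q) \<le> Y ^ 6 * (u * d6)" using q0 Y by (intro mult_left_mono) auto
    also have "\<dots> = (Y ^ 6 * u ^ 6) * Y ^ 5 * d6" using Y6u Yu6 by (simp add: mult.assoc[symmetric])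
    also have "\<dots> = Y ^ 10 * u ^ 6 * (Y * d6)" by (simp add: eval_nat_numeral mult_ac)
    also have "\<dots> \<le> Y ^ 10 * u ^ 6 * (Y * d6 + q)"
      using q0 Y u by (intro mult_left_mono) auto
    finally have le: "Y ^ 6 * (u * d6 - q) \<le> u ^ 6 * (Y * d6 + q) * Y ^ 10"
      by (simp add: mult_ac)
    show AB: "B \<le> A * Y ^ 10"
      unfolding A_def B_def times_divide_eq_left using le Y u by (intro divide_right_mono) auto
    fix n :: nat assume n: "n \<ge> 7"
    have A: "A \<ge> 0" using q0 d6_nonneg Y u by (simp add: A_def)
    have "u ^ n \<le> u ^ 7" using u n by (intro power_decreasing) auto
    then have "B * u ^ n \<le> (A * Y ^ 10) * u ^ 7"
      using AB B u by (intro mult_mono) auto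
    also have "\<dots> = A * (Y * u) ^ 7 * Y ^ 3" by (simp add: eval_nat_numeral mult_ac)
    also have "\<dots> = A * Y ^ 3" using Yu by simp
    also have "\<dots> \<le> A * Y ^ n" using A Y n by (intro mult_left_mono power_increasing) auto
    finally have "\<bar>B * (- u) ^ n\<bar> \<le> A * Y ^ n"
      using B u by (simp add: abs_mult power_abs)
    then have "d n \<ge> 0" unfolding d_def by linarith
    moreover have "cmod (char_det P6_edge n z) = \<bar>d n\<bar>"
      using D[of n] n by (simp add: norm_mult norm_power)
    ultimately show "cmod_char_poly (P6_graph n) Y = A * Y ^ n + B * (- 1 / Y) ^ n"
      using n by (simp add: poly_char_poly_P6_graph z_def x_def u_def d_def)
  qed
qed

section \<open>Comparing energy differences of two orders\<close>

lemma energy_difference_mono: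
  assumes n: "n \<ge> 7" and m: "m \<ge> 7"
    and le: "\<And>Y. Y > 1 \<Longrightarrow>
      cmod_char_poly (cycle_graph n) Y *
      cmod_char_poly (P6_graph m) Y \<le>
      cmod_char_poly (P6_graph n) Y *
      cmod_char_poly (cycle_graph m) Y"
  shows "graph_energy (P6_graph m) - graph_energy (cycle_graph m)
    \<le> graph_energy (P6_graph n) - graph_energy (cycle_graph n)"
proof -
  obtain rn where rn: "length rn = n" "real_rooted (char_poly (adjacency_matrix (P6_graph n))) rn"
    using P6_graph_real_rooted[OF n] by blast
  obtain rm where rm: "length rm = m" "real_rooted (char_poly (adjacency_matrix (P6_graph m))) rm"
    using P6_graph_real_rooted[OF m] by blast
  have "graph_energy (cycle_graph n) + graph_energy (P6_graph m)
      \<le> graph_energy (P6_graph n) + graph_energy (cycle_graph m)"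
  proof (rule energy_sum_mono[OF rn(2,1) cycle_graph_real_rooted _ cycle_graph_real_rooted _ rm(2,1)])
    fix x :: real assume x: "x > 0"
    \<comment> \<open>The positive root of Y^2 - xY - 1, so that
      \<open>x = Y - 1 / Y\<close>.\<close>
    define Y where "Y = (x + sqrt (x\<^sup>2 + 4)) / 2"
    have "sqrt (x\<^sup>2 + 4) > sqrt 4" using x by (intro real_sqrt_less_mono) simp
    then have Y1: "Y > 1" using x by (simp add: Y_def)
    have "(sqrt (x\<^sup>2 + 4))\<^sup>2 = x\<^sup>2 + 4" by simp
    then have "Y\<^sup>2 = x * Y + 1"
      unfolding Y_def by (simp add: power2_eq_square field_simps)
    then have "x = Y - 1 / Y"
      using Y1 by (simp add: power2_eq_square field_simps)
    with le[OF Y1] show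
      "cmod (poly (char_poly (adjacency_matrix (cycle_graph n))) (\<i> * complex_of_real x)) *
      cmod (poly (char_poly (adjacency_matrix (P6_graph m))) (\<i> * complex_of_real x)) \<le>
      cmod (poly (char_poly (adjacency_matrix (P6_graph n))) (\<i> * complex_of_real x)) *
      cmod (poly (char_poly (adjacency_matrix (cycle_graph m))) (\<i> * complex_of_real x))"
      by simp
  qed (use n m in auto)
  then show ?thesis by simp
qed

text \<open>The order \<open>n\<close> may lie below \<open>m\<close>, so that 8 and 12 can be
  compared with 14. The small modulus of the cycle of order \<open>n\<close>, with its -2, against
  the large one of order \<open>m\<close>, with its +2, leaves enough room.\<close>

lemma energy_difference_mono_4k:
  assumes n: "n \<ge> 7" "n mod 4 = 0" and m: "m \<ge> 10" "m mod 4 = 2"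
  shows "graph_energy (P6_graph m) - graph_energy (cycle_graph m)
    \<le> graph_energy (P6_graph n) - graph_energy (cycle_graph n)"
proof (rule energy_difference_mono)
  fix Y :: real assume Y: "Y > 1"
  obtain A B where B: "0 \<le> B" "B \<le> A * Y ^ 10" and P: "\<And>n. n \<ge> 7 \<Longrightarrow>
      cmod_char_poly (P6_graph n) Y
        = A * Y ^ n + B * (- 1 / Y) ^ n"
    using cmod_P6_graph[OF Y] by metis
  have "even n" "even m" using n m by presburger+
  define z w where "z = Y ^ n" and "w = Y ^ m"
  have zw: "z > 1" "w \<ge> Y ^ 10" "w > 1"
    unfolding z_def w_def using Y n m by (auto intro!: power_increasing one_less_power)
  have "0 \<le> A * Y ^ 10" using B by linarith
  then have "0 \<le> A" using Y by (simp add: zero_le_mult_iff)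
  then have Bw: "B \<le> A * w" using B zw by (meson mult_left_mono order_trans)
  \<comment> \<open>This is the cleared inequality after cancelling \<open>A * z^2 * w^2\<close>.
    The term in \<open>B * (z - 1)^2\<close> is absorbed by \<open>B \<le> A * w\<close>, where
    \<open>m \<ge> 10\<close> enters.\<close>
  have "A * z\<^sup>2 * (2 * w + 1) + A * w\<^sup>2 * (2 * z - 1) + B * (w + 1)\<^sup>2 \<ge> B * (z - 1)\<^sup>2"
  proof -
    have "(z - 1)\<^sup>2 \<le> z\<^sup>2" using zw by (intro power_mono) auto
    then have "B * (z - 1)\<^sup>2 \<le> (A * w) * z\<^sup>2" using Bw B by (intro mult_mono) auto
    also have "\<dots> \<le> A * z\<^sup>2 * (2 * w + 1)"
      using \<open>0 \<le> A\<close> zw by (simp add: algebra_simps)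
    moreover have "0 \<le> A * w\<^sup>2 * (2 * z - 1)" "0 \<le> B * (w + 1)\<^sup>2"
      using \<open>0 \<le> A\<close> B zw by auto
    ultimately show ?thesis by linarith
  qed
  then have "(z - 1)\<^sup>2 * (A * w\<^sup>2 + B) \<le> (A * z\<^sup>2 + B) * (w + 1)\<^sup>2"
    by (simp add: power2_eq_square algebra_simps)
  then have "(z - 1)\<^sup>2 * (A * w\<^sup>2 + B) / (z * w) \<le> (A * z\<^sup>2 + B) * (w + 1)\<^sup>2 / (z * w)"
    using zw by (intro divide_right_mono) auto
  moreover have "(z - 1)\<^sup>2 * (A * w\<^sup>2 + B) / (z * w) = (z + 1 / z - 2) * (A * w + B / w)"
    "(A * z\<^sup>2 + B) * (w + 1)\<^sup>2 / (z * w) = (A * z + B / z) * (w + 1 / w + 2)"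
    using zw by (simp_all add: field_simps power2_eq_square)
  ultimately show
    "cmod_char_poly (cycle_graph n) Y *
      cmod_char_poly (P6_graph m) Y \<le>
      cmod_char_poly (P6_graph n) Y *
      cmod_char_poly (cycle_graph m) Y"
    using P[of n] P[of m] cmod_cycle_graph(1)[of n Y] cmod_cycle_graph(2)[of m Y] n m Y
      \<open>even n\<close> \<open>even m\<close>
    by (simp add: z_def w_def power_divide)
qed (use n m in auto)

text \<open>Once \<open>z * w\<close> is cleared, the difference of the two sides is
  \<open>(z - w) * (A * (2 * z * w + z + w) - B * (z + w + 2))\<close>. Its second factor is
  nonnegative because \<open>B \<le> A * w\<close> and \<open>w \<le> z\<close>.\<close>

lemma energy_difference_mono_4k_2:
  assumes m: "m \<ge> 10" "m mod 4 = 2" and n: "n \<ge> m" "n mod 4 = 2"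
  shows "graph_energy (P6_graph m) - graph_energy (cycle_graph m)
    \<le> graph_energy (P6_graph n) - graph_energy (cycle_graph n)"
proof (rule energy_difference_mono)
  fix Y :: real assume Y: "Y > 1"
  obtain A B where B: "0 \<le> B" "B \<le> A * Y ^ 10" and P: "\<And>n. n \<ge> 7 \<Longrightarrow>
      cmod_char_poly (P6_graph n) Y
        = A * Y ^ n + B * (- 1 / Y) ^ n"
    using cmod_P6_graph[OF Y] by metis
  have "even n" "even m" using n m by presburger+
  define z w where "z = Y ^ n" and "w = Y ^ m"
  have zw: "z \<ge> w" "w \<ge> Y ^ 10" "w > 1"
    unfolding z_def w_def using Y n m by (auto intro!: power_increasing one_less_power)
  have "0 \<le> A * Y ^ 10" using B by linarith
  then have "0 \<le> A" using Y by (simp add: zero_le_mult_iff)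
  then have Bw: "B \<le> A * w" using B zw by (meson mult_left_mono order_trans)
  have "B * (z + w + 2) \<le> (A * w) * (z + w + 2)"
    using Bw zw by (intro mult_right_mono) auto
  also have "\<dots> \<le> A * (2 * z * w + z + w)"
  proof -
    have "w * w \<le> w * z" using zw by (intro mult_left_mono) auto
    then have "w * (z + w + 2) \<le> 2 * z * w + z + w"
      using zw by (simp add: algebra_simps add_mono)
    then show ?thesis using \<open>0 \<le> A\<close> by (simp add: mult_left_mono mult.assoc)
  qed
  finally have "0 \<le> (z - w) * (A * (2 * z * w + z + w) - B * (z + w + 2))"
    using zw by (intro mult_nonneg_nonneg) auto
  then have "(z + 1)\<^sup>2 * (A * w\<^sup>2 + B) \<le> (A * z\<^sup>2 + B) * (w + 1)\<^sup>2"
    by (simp add: power2_eq_square algebra_simps)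
  then have "(z + 1)\<^sup>2 * (A * w\<^sup>2 + B) / (z * w) \<le> (A * z\<^sup>2 + B) * (w + 1)\<^sup>2 / (z * w)"
    using zw by (intro divide_right_mono) auto
  moreover have "(z + 1)\<^sup>2 * (A * w\<^sup>2 + B) / (z * w) = (z + 1 / z + 2) * (A * w + B / w)"
    "(A * z\<^sup>2 + B) * (w + 1)\<^sup>2 / (z * w) = (A * z + B / z) * (w + 1 / w + 2)"
    using zw by (simp_all add: field_simps power2_eq_square)
  ultimately show
    "cmod_char_poly (cycle_graph n) Y *
      cmod_char_poly (P6_graph m) Y \<le>
      cmod_char_poly (P6_graph n) Y *
      cmod_char_poly (cycle_graph m) Y"
    using P[of n] P[of m] cmod_cycle_graph(2)[of n Y] cmod_cycle_graph(2)[of m Y] n m Y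
      \<open>even n\<close> \<open>even m\<close>
    by (simp add: z_def w_def power_divide)
qed (use n m in auto)

text \<open>Once \<open>z * w\<close> is cleared, the difference of the two sides is
  \<open>(A + B) * (z^2 - w^2)\<close>.\<close>

lemma energy_difference_mono_odd:
  assumes m: "m \<ge> 7" "odd m" and n: "n \<ge> m" "odd n"
  shows "graph_energy (P6_graph m) - graph_energy (cycle_graph m)
    \<le> graph_energy (P6_graph n) - graph_energy (cycle_graph n)"
proof (rule energy_difference_mono)
  fix Y :: real assume Y: "Y > 1"
  obtain A B where B: "0 \<le> B" "B \<le> A * Y ^ 10" and P: "\<And>n. n \<ge> 7 \<Longrightarrow>
      cmod_char_poly (P6_graph n) Y
        = A * Y ^ n + B * (- 1 / Y) ^ n"
    using cmod_P6_graph[OF Y] by metis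
  define z w where "z = Y ^ n" and "w = Y ^ m"
  have zw: "z \<ge> w" "w > 1"
    unfolding z_def w_def using Y n m by (auto intro!: power_increasing one_less_power)
  have "0 \<le> A * Y ^ 10" using B by linarith
  then have "0 \<le> A" using Y by (simp add: zero_le_mult_iff)
  have "w\<^sup>2 \<le> z\<^sup>2" using zw by (intro power_mono) auto
  then have "(A + B) * w\<^sup>2 \<le> (A + B) * z\<^sup>2"
    using \<open>0 \<le> A\<close> B by (intro mult_left_mono) auto
  then have "(z\<^sup>2 + 1) * (A * w\<^sup>2 - B) \<le> (A * z\<^sup>2 - B) * (w\<^sup>2 + 1)"
    by (simp add: algebra_simps)
  then have "(z\<^sup>2 + 1) * (A * w\<^sup>2 - B) / (z * w) \<le> (A * z\<^sup>2 - B) * (w\<^sup>2 + 1) / (z * w)"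
    using zw by (intro divide_right_mono) auto
  moreover have "(z\<^sup>2 + 1) * (A * w\<^sup>2 - B) / (z * w) = (z + 1 / z) * (A * w - B / w)"
    "(A * z\<^sup>2 - B) * (w\<^sup>2 + 1) / (z * w) = (A * z - B / z) * (w + 1 / w)"
    using zw by (simp_all add: field_simps power2_eq_square)
  ultimately show
    "cmod_char_poly (cycle_graph n) Y *
      cmod_char_poly (P6_graph m) Y \<le>
      cmod_char_poly (P6_graph n) Y *
      cmod_char_poly (cycle_graph m) Y"
    using P[of n] P[of m] cmod_cycle_graph(3)[of n Y] cmod_cycle_graph(3)[of m Y] n m Y
    by (simp add: z_def w_def power_divide)
qed (use n m in auto)

subsection \<open>The graphs of order 14 and 17\<close>

lemma sum_abs_real_roots_le_graph_energy:
  assumes "finite R"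
    and root: "\<And>x. x \<in> R \<Longrightarrow> poly (char_poly (adjacency_matrix G)) (complex_of_real x) = 0"
  shows "(\<Sum>x\<in>R. \<bar>x\<bar>) \<le> graph_energy G"
proof -
  let ?p = "char_poly (adjacency_matrix G)"
  have nz: "?p \<noteq> 0"
    using degree_monic_char_poly[OF adjacency_matrix_carrier[of G]] by auto
  have sub: "complex_of_real ` R \<subseteq> spectrum (adjacency_matrix G)"
    unfolding spectrum_root_char_poly[OF adjacency_matrix_carrier] using root by auto
  have "(\<Sum>x\<in>R. \<bar>x\<bar>) = (\<Sum>k\<in>complex_of_real ` R. cmod k)"
    by (subst sum.reindex) (auto simp: inj_on_def)
  also have "\<dots> \<le> (\<Sum>k\<in>complex_of_real ` R. real (order k ?p) * cmod k)"
  proof (rule sum_mono)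
    fix k assume "k \<in> complex_of_real ` R"
    then have "order k ?p \<ge> 1"
      using nz root by (auto simp: order_root Suc_le_eq)
    then have "real (order k ?p) \<ge> 1" by linarith
    then show "cmod k \<le> real (order k ?p) * cmod k"
      using mult_right_mono[of 1 "real (order k ?p)" "cmod k"] by simp
  qed
  also have "\<dots> \<le> graph_energy G"
    unfolding graph_energy_def
    using card_finite_spectrum(1)[OF adjacency_matrix_carrier[of G]] sub
    by (intro sum_mono2) auto
  finally show ?thesis .
qed

text \<open>Each sign change yields a root strictly above its left endpoint. These \<open>k\<close>
  roots are positive and distinct, and their negatives are roots as well, which gives the factor
  2.\<close>

lemma graph_energy_ge_sign_changes:
  fixes f :: "real \<Rightarrow> real" and q :: "nat \<Rightarrow> real"
  assumes p: "\<And>x. poly (char_poly (adjacency_matrix G)) (complex_of_real x) = complex_of_real (f x)"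
    and cont: "continuous_on UNIV f"
    and sym: "\<And>x. f x = 0 \<Longrightarrow> f (- x) = 0"
    and q0: "q 0 > 0"
    and q_less: "\<And>i. i < k \<Longrightarrow> q i < q (Suc i)"
    and sign: "\<And>i. i < k \<Longrightarrow> f (q i) * f (q (Suc i)) < 0"
  shows "2 * (\<Sum>i<k. q i) \<le> graph_energy G"
proof -
  have "\<exists>r. q i < r \<and> r < q (Suc i) \<and> f r = 0" if "i < k" for i
  proof -
    have c: "continuous_on {q i..q (Suc i)} f" using cont continuous_on_subset by blast
    have "\<exists>r\<ge>q i. r \<le> q (Suc i) \<and> f r = 0"
    proof (cases "f (q i) \<le> 0")
      case True
      then show ?thesis
        using IVT'[of f "q i" 0 "q (Suc i)"] sign[OF that] q_less[OF that] c
        by (auto simp: mult_less_0_iff)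
    next
      case False
      then show ?thesis
        using IVT2'[of f "q (Suc i)" 0 "q i"] sign[OF that] q_less[OF that] c
        by (auto simp: mult_less_0_iff)
    qed
    then obtain r where r: "q i \<le> r" "r \<le> q (Suc i)" "f r = 0" by blast
    with sign[OF that] have "r \<noteq> q i" "r \<noteq> q (Suc i)" by auto
    with r show ?thesis by (intro exI[of _ r]) auto
  qed
  then obtain r where r: "\<And>i. i < k \<Longrightarrow> q i < r i" "\<And>i. i < k \<Longrightarrow> r i < q (Suc i)"
      "\<And>i. i < k \<Longrightarrow> f (r i) = 0"
    by metis
  have q_mono: "q i \<le> q j" if "i \<le> j" "j \<le> k" for i j
    using that
  proof (induction rule: dec_induct)
    case (step n)
    then show ?case using q_less[of n] by simp
  qed simp
  have r_pos: "r i > 0" if "i < k" for i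
    using q0 q_mono[of 0 i] r(1)[OF that] that by simp
  have r_mono: "r i < r j" if "i < j" "j < k" for i j
    using r(2)[of i] r(1)[of j] q_mono[of "Suc i" j] that by simp
  then have inj: "inj_on r {..<k}"
    by (intro inj_onI) (metis lessThan_iff linorder_neqE_nat less_irrefl)
  define R where "R = r ` {..<k}"
  have R_pos: "x > 0" if "x \<in> R" for x using that r_pos by (auto simp: R_def)
  have "(\<Sum>x\<in>R \<union> uminus ` R. \<bar>x\<bar>) \<le> graph_energy G"
    by (rule sum_abs_real_roots_le_graph_energy) (use r(3) sym p in \<open>auto simp: R_def\<close>)
  also have "(\<Sum>x\<in>R \<union> uminus ` R. \<bar>x\<bar>) = (\<Sum>x\<in>R. \<bar>x\<bar>) + (\<Sum>x\<in>uminus ` R. \<bar>x\<bar>)"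
  proof (rule sum.union_disjoint)
    have False if "x \<in> R" "- x \<in> R" for x using R_pos[OF that(1)] R_pos[OF that(2)] by simp
    then show "R \<inter> uminus ` R = {}" by force
  qed (simp_all add: R_def)
  also have "(\<Sum>x\<in>uminus ` R. \<bar>x\<bar>) = (\<Sum>x\<in>R. \<bar>x\<bar>)"
    by (subst sum.reindex) (auto simp: inj_on_def)
  also have "(\<Sum>x\<in>R. \<bar>x\<bar>) = (\<Sum>i<k. r i)"
    unfolding R_def using inj r_pos by (subst sum.reindex) (auto simp: less_imp_le)
  finally have "2 * (\<Sum>i<k. r i) \<le> graph_energy G" by simp
  moreover have "(\<Sum>i<k. q i) \<le> (\<Sum>i<k. r i)"
    using r(1) by (intro sum_mono) (auto simp: less_imp_le)
  ultimately show ?thesis by simp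
qed

text \<open>The characteristic polynomial of order \<open>6 + k\<close> with real coefficients,
  starting from C_6 and P_7^6 and made for computing explicit coefficients.\<close>

fun P6_poly :: "nat \<Rightarrow> real poly" where
  "P6_poly 0 = [:- 4, 0, 9, 0, - 6, 0, 1:]"
| "P6_poly (Suc 0) = [:0, - 7, 0, 13, 0, - 7, 0, 1:]"
| "P6_poly (Suc (Suc k)) = pCons 0 (P6_poly (Suc k)) - P6_poly k"

lemma poly_P6_poly_minus: "poly (P6_poly k) (- x) = (- 1) ^ k * poly (P6_poly k) x"
  by (induction k rule: P6_poly.induct) (simp_all add: algebra_simps)

text \<open>Writing z = y + 1/y with complex y turns y^6 + 1/y^6 - 2 into (y^3 + 1/y^3)^2 - 4 = (z^3
  - 3z)^2 - 4.\<close>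

lemma char_det_P6_6_of_real:
  "char_det P6_edge 6 (complex_of_real x) = complex_of_real (poly (P6_poly 0) x)"
proof -
  define z y where "z = complex_of_real x" and "y = (z + csqrt (z\<^sup>2 - 4)) / 2"
  have "2 * y - z = csqrt (z\<^sup>2 - 4)" by (simp add: y_def field_simps)
  then have "(2 * y - z)\<^sup>2 = z\<^sup>2 - 4" by simp
  moreover have "4 * (y * (z - y)) = z\<^sup>2 - (2 * y - z)\<^sup>2"
    by (simp add: power2_eq_square algebra_simps)
  ultimately have y2: "y * (z - y) = 1" by simp
  then have y0: "y \<noteq> 0" by auto
  then have u: "z - y = 1 / y" using y2 by (simp add: field_simps)
  have cube: "y ^ 3 + (1 / y) ^ 3 = z ^ 3 - 3 * z"
  proof -
    have "y ^ 3 + (z - y) ^ 3 = z ^ 3 - 3 * (y * (z - y)) * z"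
      by (simp add: power3_eq_cube algebra_simps)
    then have "y ^ 3 + (z - y) ^ 3 = z ^ 3 - 3 * z" unfolding y2 by simp
    then show ?thesis unfolding u .
  qed
  have "(y ^ 3 + (1 / y) ^ 3)\<^sup>2 = y ^ 6 + 1 / y ^ 6 + 2"
    using y0 by (simp add: power2_sum power_divide flip: power_mult)
  then have "y ^ 6 + 1 / y ^ 6 - 2 = (z ^ 3 - 3 * z)\<^sup>2 - 4" unfolding cube by simp
  moreover have "char_det P6_edge 6 (y + 1 / y) = y ^ 6 + 1 / y ^ 6 - 2"
    unfolding char_det_P6_6 using y0 by (intro poly_char_poly_cycle_graph) auto
  moreover have "y + 1 / y = z" using u by (simp add: algebra_simps)
  ultimately have "char_det P6_edge 6 z = (z ^ 3 - 3 * z)\<^sup>2 - 4" by simp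
  then show ?thesis
    unfolding z_def by (simp add: algebra_simps power2_eq_square power_numeral_reduce)
qed

lemma char_det_P6_of_real:
  "char_det P6_edge (6 + k) (complex_of_real x) = complex_of_real (poly (P6_poly k) x)"
proof (induction k rule: P6_poly.induct)
  case 1
  then show ?case using char_det_P6_6_of_real by simp
next
  case 2
  then show ?case
    using char_det_P6_7[of "complex_of_real x"] char_det_P6_6_of_real[of x]
    by (simp add: algebra_simps power_numeral_reduce)
next
  case (3 k)
  then show ?case using char_det_P6_Suc_Suc[of "6 + k" "complex_of_real x"] by simp
qed

lemma graph_energy_P6_ge_sign_changes:
  assumes "k > 0" "q 0 > 0"
    and "\<And>i. i < m \<Longrightarrow> q i < q (Suc i)"
    and "\<And>i. i < m \<Longrightarrow> poly (P6_poly k) (q i) * poly (P6_poly k) (q (Suc i)) < 0"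
  shows "2 * (\<Sum>i<m. q i) \<le> graph_energy (P6_graph (6 + k))"
proof (rule graph_energy_ge_sign_changes[where f = "poly (P6_poly k)"])
  show "poly (char_poly (adjacency_matrix (P6_graph (6 + k)))) (complex_of_real x)
      = complex_of_real (poly (P6_poly k) x)" for x
    using assms(1) by (simp add: poly_char_poly_P6_graph char_det_P6_of_real)
qed (use assms in \<open>auto intro!: continuous_intros simp: poly_P6_poly_minus\<close>)

lemma graph_energy_P6_14: "graph_energy (P6_graph 14) \<ge> 17.9866"
proof -
  \<comment> \<open>The first seven points are lower estimates of the seven positive roots, and
    twice their sum is 17.9866. The last point only closes the final interval.\<close>
  define qs :: "real list" where "qs = [0.2973, 0.845, 0.999, 1.253, 1.574, 1.867, 2.158, 2.16]"
  have p: "P6_poly 8 = [:- 4, 0, 61, 0, - 202, 0, 286, 0, - 204, 0, 76, 0, - 14, 0, 1:]"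
    by (simp add: numeral_eq_Suc)
  have "2 * (\<Sum>i<7. qs ! i) \<le> graph_energy (P6_graph (6 + 8))"
  proof (rule graph_energy_P6_ge_sign_changes)
    fix i :: nat assume "i < 7"
    then consider "i = 0" | "i = 1" | "i = 2" | "i = 3" | "i = 4" | "i = 5" | "i = 6" by linarith
    then show "qs ! i < qs ! Suc i" "poly (P6_poly 8) (qs ! i) * poly (P6_poly 8) (qs ! Suc i) < 0"
      unfolding p
      by (cases; simp add: qs_def)+
  qed (simp_all add: qs_def)
  then show ?thesis by (simp add: qs_def eval_nat_numeral)
qed

lemma graph_energy_P6_17: "graph_energy (P6_graph 17) \<ge> 21.6836"
proof -
  \<comment> \<open>Lower estimates of the eight positive roots, followed by a closing point;
    \<open>0.9999\<close> and \<open>1.732\<close> lie just below the exact roots 1 and sqrt 3. The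
    root 0 adds nothing to the energy.\<close>
  define qs :: "real list" where
    "qs = [0.459, 0.8775, 0.9999, 1.2119, 1.4795, 1.732, 1.924, 2.158, 2.16]"
  have p: "P6_poly 11 = [:0, 27, 0, - 243, 0, 741, 0, - 1103, 0, 909, 0, - 433, 0, 118, 0, - 17, 0, 1:]"
    by (simp add: numeral_eq_Suc)
  have "2 * (\<Sum>i<8. qs ! i) \<le> graph_energy (P6_graph (6 + 11))"
  proof (rule graph_energy_P6_ge_sign_changes)
    fix i :: nat assume "i < 8"
    then consider "i = 0" | "i = 1" | "i = 2" | "i = 3" | "i = 4" | "i = 5" | "i = 6" | "i = 7"
      by linarith
    then show "qs ! i < qs ! Suc i" "poly (P6_poly 11) (qs ! i) * poly (P6_poly 11) (qs ! Suc i) < 0"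
      unfolding p
      by (cases; simp add: qs_def)+
  qed (simp_all add: qs_def)
  then show ?thesis by (simp add: qs_def eval_nat_numeral)
qed

section \<open>Dirichlet kernel and upper bounds for the energies of C_14 and C_17\<close>

lemma sin_times_sum_cos:
  fixes h :: real
  shows "sin h * (1 + 2 * (\<Sum>j=1..m. cos (2 * real j * h))) = sin ((2 * real m + 1) * h)"
proof (induction m)
  case (Suc m)
  have "(2 * real (Suc m) + 1) * h = 2 * real (Suc m) * h + h"
    "(2 * real m + 1) * h = 2 * real (Suc m) * h - h"
    by (simp_all add: algebra_simps)
  \<comment> \<open>The product-to-sum formula makes the cosine sum telescope.\<close>
  then have "sin ((2 * real (Suc m) + 1) * h) - sin ((2 * real m + 1) * h)
      = 2 * sin h * cos (2 * real (Suc m) * h)"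
    by (simp only: sin_add sin_diff) simp
  with Suc show ?case by (simp add: algebra_simps)
qed simp

text \<open>Taylor expansion to order 4; the quintic term is the bound on the remainder, hence its
  negative sign.\<close>

lemma sin_ge_quintic:
  fixes x :: real
  assumes "0 \<le> x"
  shows "x - x ^ 3 / 6 - x ^ 5 / 120 \<le> sin x"
proof -
  have "{..<5 :: nat} = {0, 1, 2, 3, 4}" by auto
  then have "(\<Sum>m<5. sin_coeff m * x ^ m) = x - x ^ 3 / 6"
    by (simp add: sin_coeff_def fact_numeral)
  moreover have "inverse (fact 5) * \<bar>x\<bar> ^ 5 = x ^ 5 / 120"
    using assms by (simp add: fact_numeral)
  ultimately show ?thesis using Maclaurin_sin_bound[of x 5] by linarith
qed

lemma graph_energy_cycle_graph:
  assumes "n \<ge> 3"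
  shows "graph_energy (cycle_graph n) = 2 * (\<Sum>k<n. \<bar>cos (2 * pi * real k / real n)\<bar>)"
proof -
  have "graph_energy (cycle_graph n)
      = (\<Sum>k\<leftarrow>[0..<n]. cmod (complex_of_real (2 * cos (2 * pi * real k / real n))))"
    using graph_energy_eq_sum_list[OF char_poly_cycle_graph[OF assms]] by (simp only: map_map o_def)
  also have "\<dots> = (\<Sum>k<n. 2 * \<bar>cos (2 * pi * real k / real n)\<bar>)"
    unfolding norm_of_real by (simp add: sum_list_distinct_conv_sum_set atLeast0LessThan abs_mult)
  finally show ?thesis by (simp add: sum_distrib_left)
qed

lemma abs_cos_pi_minus: "\<bar>cos (pi - x)\<bar> = \<bar>cos x\<bar>" and abs_cos_pi_plus: "\<bar>cos (pi + x)\<bar> = \<bar>cos x\<bar>"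
  for x :: real
  by simp_all

text \<open>The absolute cosines have period 7 in the index and are symmetric in each period, so the
  energy is four times a Dirichlet kernel with value \<open>1 / sin h\<close>, since
  \<open>sin (7 * h) = 1\<close>.\<close>

lemma graph_energy_cycle_graph_14: "graph_energy (cycle_graph 14) < 17.9866"
proof -
  define h where "h = pi / 14"
  define c where "c = (\<lambda>j :: nat. \<bar>cos (real j * (2 * h))\<bar>)"
  have per: "c (7 + j) = c j" for j
    unfolding c_def h_def using abs_cos_pi_plus[of "real j * (2 * (pi / 14))"]
    by (simp add: algebra_simps)
  have refl: "c j = c (7 - j)" if "j \<le> 7" for j
  proof -
    have "pi - real j * (2 * h) = real (7 - j) * (2 * h)"
      using that by (simp add: h_def of_nat_diff field_simps)
    then show ?thesis unfolding c_def by (metis abs_cos_pi_minus)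
  qed
  have pos: "c j = cos (real j * (2 * h))" if "j \<le> 3" for j
  proof -
    have "0 < h" "pi / 2 = 7 * h" by (simp_all add: h_def)
    moreover from this have "real j * (2 * h) \<le> 3 * (2 * h)" "0 \<le> real j * (2 * h)"
      using that by (auto intro!: mult_right_mono)
    ultimately show ?thesis unfolding c_def by (intro abs_of_nonneg cos_ge_zero) linarith+
  qed
  have "graph_energy (cycle_graph 14) = 2 * (\<Sum>k<14. c k)"
    by (subst graph_energy_cycle_graph) (simp_all add: c_def h_def mult_ac)
  also have "(\<Sum>k<14. c k) = 2 * (1 + 2 * (\<Sum>j=1..3. cos (2 * real j * h)))"
  proof -
    have "{..<14 :: nat} = {0, 1, 2, 3, 4, 5, 6, 7, 8, 9, 10, 11, 12, 13}" by auto presburger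
    moreover have "{1..3 :: nat} = {1, 2, 3}" by auto
    ultimately show ?thesis
      using per[of 0] per[of 1] per[of 2] per[of 3] per[of 4] per[of 5] per[of 6]
        refl[of 4] refl[of 5] refl[of 6] pos[of 0] pos[of 1] pos[of 2] pos[of 3]
      by (simp add: mult_ac)
  qed
  finally have E: "graph_energy (cycle_graph 14) = 4 * (1 + 2 * (\<Sum>j=1..3. cos (2 * real j * h)))"
    by simp
  have "sin h * (1 + 2 * (\<Sum>j=1..3. cos (2 * real j * h))) = 1"
    using sin_times_sum_cos[of h 3] by (simp add: h_def)
  then have prod: "sin h * graph_energy (cycle_graph 14) = 4" unfolding E mult.left_commute[of "sin h"] by simp
  \<comment> \<open>\<open>0.2243\<close> is slightly below pi/14, and 4 / 0.22239 is still below
    17.9866.\<close>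
  have "0.22239 \<le> (0.2243 :: real) - 0.2243 ^ 3 / 6 - 0.2243 ^ 5 / 120"
    by (simp add: power_divide)
  also have "\<dots> \<le> sin 0.2243" by (rule sin_ge_quintic) simp
  also have "\<dots> \<le> sin h"
    using pi_approx by (intro sin_monotone_2pi_le) (auto simp: h_def)
  finally have sin: "0.22239 \<le> sin h" .
  then have "0.22239 * graph_energy (cycle_graph 14) \<le> 4"
    unfolding prod[symmetric]
    by (intro mult_right_mono) (simp_all add: graph_energy_def sum_nonneg)
  then show ?thesis by simp
qed

text \<open>The angles are even multiples of pi/17. Modulo 17 and up to reflection, the indices
  \<open>2 * k\<close> hit 0 once and each of 1, ..., 8 twice, so the energy is twice a Dirichlet
  kernel with value \<open>1 / sin h\<close>.\<close>

lemma graph_energy_cycle_graph_17: "graph_energy (cycle_graph 17) < 21.6836"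
proof -
  define h where "h = pi / 34"
  define c where "c = (\<lambda>j :: nat. \<bar>cos (real j * (2 * h))\<bar>)"
  have per: "c (17 + j) = c j" for j
    unfolding c_def h_def using abs_cos_pi_plus[of "real j * (2 * (pi / 34))"]
    by (simp add: algebra_simps)
  have refl: "c j = c (17 - j)" if "j \<le> 17" for j
  proof -
    have "pi - real j * (2 * h) = real (17 - j) * (2 * h)"
      using that by (simp add: h_def of_nat_diff field_simps)
    then show ?thesis unfolding c_def by (metis abs_cos_pi_minus)
  qed
  have pos: "c j = cos (real j * (2 * h))" if "j \<le> 8" for j
  proof -
    have "0 < h" "pi / 2 = 17 * h" by (simp_all add: h_def)
    moreover from this have "real j * (2 * h) \<le> 8 * (2 * h)" "0 \<le> real j * (2 * h)"
      using that by (auto intro!: mult_right_mono)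
    ultimately show ?thesis unfolding c_def by (intro abs_of_nonneg cos_ge_zero) linarith+
  qed
  have "graph_energy (cycle_graph 17) = 2 * (\<Sum>k<17. c (2 * k))"
    by (subst graph_energy_cycle_graph) (simp_all add: c_def h_def mult_ac)
  also have "(\<Sum>k<17. c (2 * k)) = 1 + 2 * (\<Sum>j=1..8. cos (2 * real j * h))"
  proof -
    have "{..<17 :: nat} = {0, 1, 2, 3, 4, 5, 6, 7, 8, 9, 10, 11, 12, 13, 14, 15, 16}"
      by auto presburger
    moreover have "{1..8 :: nat} = {1, 2, 3, 4, 5, 6, 7, 8}" by auto
    ultimately show ?thesis
      using refl[of 9] refl[of 10] refl[of 11] refl[of 12] refl[of 13] refl[of 14] refl[of 15]
        refl[of 16] per[of 1] per[of 3] per[of 5] per[of 7] per[of 9] per[of 11] per[of 13] per[of 15]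
        pos[of 0] pos[of 1] pos[of 2] pos[of 3] pos[of 4] pos[of 5] pos[of 6] pos[of 7] pos[of 8]
      by (simp add: mult_ac)
  qed
  finally have E: "graph_energy (cycle_graph 17) = 2 * (1 + 2 * (\<Sum>j=1..8. cos (2 * real j * h)))" .
  have "sin h * (1 + 2 * (\<Sum>j=1..8. cos (2 * real j * h))) = 1"
    using sin_times_sum_cos[of h 8] by (simp add: h_def)
  then have prod: "sin h * graph_energy (cycle_graph 17) = 2" unfolding E mult.left_commute[of "sin h"] by simp
  \<comment> \<open>\<open>0.09239\<close> is slightly below pi/34, and 2 / 0.09224 is still below
    21.6836.\<close>
  have "0.09224 \<le> (0.09239 :: real) - 0.09239 ^ 3 / 6 - 0.09239 ^ 5 / 120"
    by (simp add: power_divide)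
  also have "\<dots> \<le> sin 0.09239" by (rule sin_ge_quintic) simp
  also have "\<dots> \<le> sin h"
    using pi_approx by (intro sin_monotone_2pi_le) (auto simp: h_def)
  finally have sin: "0.09224 \<le> sin h" .
  then have "0.09224 * graph_energy (cycle_graph 17) \<le> 2"
    unfolding prod[symmetric]
    by (intro mult_right_mono) (simp_all add: graph_energy_def sum_nonneg)
  then show ?thesis by simp
qed

theorem theorem1p3:
  fixes n :: nat
  assumes "n \<in> {8, 12, 14} \<or> n \<ge> 16"
  shows "graph_energy (P6_graph n) > graph_energy (cycle_graph n)"
proof -
  have base14: "graph_energy (P6_graph 14) > graph_energy (cycle_graph 14)"
    using graph_energy_P6_14 graph_energy_cycle_graph_14 by linarith
  have base17: "graph_energy (P6_graph 17) > graph_energy (cycle_graph 17)"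
    using graph_energy_P6_17 graph_energy_cycle_graph_17 by linarith
  have "n = 8 \<or> n = 12 \<or> n = 14 \<or> n \<ge> 16" using assms by auto
  \<comment> \<open>Odd orders start at 17 and orders that are 2 modulo 4 start at 14, the two base
    cases; multiples of 4 are compared with 14 directly.\<close>
  then have "n \<ge> 7 \<and> n mod 4 = 0 \<or> n \<ge> 14 \<and> n mod 4 = 2 \<or> n \<ge> 17 \<and> odd n"
    by presburger
  then show ?thesis
  proof (elim disjE conjE)
    assume "n \<ge> 7" "n mod 4 = 0"
    then show ?thesis using energy_difference_mono_4k[of n 14] base14 by simp
  next
    assume "n \<ge> 14" "n mod 4 = 2"
    then show ?thesis using energy_difference_mono_4k_2[of 14 n] base14 by simp
  next
    assume "n \<ge> 17" "odd n"
    then show ?thesis using energy_difference_mono_odd[of 17 n] base17 by simp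
  qed
qed

end
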